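(* Consider a sequence, indexed by the number $N$ of nodes, of closed Jackson networks with infinite-capacity nodes $1,\dots,N$ (single-server nodes in $\mathcal J_1^N$, infinite-server nodes in $\mathcal J_2^N$), with $M_N$ customers, utilizations $r_{j,N}$, stationary node-occupation vector $(\xi_{j,N})_{1\le j\le N}$, chemical potential $\gamma_N$, free variables $(\eta_{j,N})_{1\le j\le N}$ and variance $b_N^2$, all defined in the context. Assume that (1) $\displaystyle\limsup_{N\to\infty}\Big(\gamma_N\max_{j\in\mathcal J_1^N} r_{j,N}\Big)<1$; (2) $\displaystyle\lim_{N\to\infty}b_N=+\infty$; (3) $K\ge1$ is an integer such that $\displaystyle\lim_{N\to\infty} b_N^{-1}\sum_{j\in\mathcal J_2^N\cap\{1,\dots,K\}}\gamma_N r_{j,N}=0$. Then for any $(n_1,\dots,n_K)\in\mathbb N^K$, $$\lim_{N\to\infty}\frac{\mathbb P(\xi_{1,N}=n_1,\dots,\xi_{K,N}=n_K)}{\mathbb P(\eta_{1,N}=n_1)\cdots\mathbb P(\eta_{K,N}=n_K)}=1 .$$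
   Context: $\mathbb N=\{0,1,2,\dots\}$. For each $N$, the set of nodes $\{1,\dots,N\}$ is the disjoint union of $\mathcal J_1^N$ (non-empty) and $\mathcal J_2^N$. $P_N=(p_{ij,N})$ is an irreducible stochastic routing matrix on $\{1,\dots,N\}$ with invariant probability vector $\theta_N=(\theta_{1,N},\dots,\theta_{N,N})$; $\mu_{j,N}>0$ is the parameter of the exponential services at node $j$; $M_N$ is the number of customers; all capacities are infinite. The occupation process is the Markov process on $$\mathcal S_{N,M_N}=\Big\{(n_1,\dots,n_N)\in\mathbb N^N:\sum_{j=1}^N n_j=M_N\Big\}$$ with transitions $n\to n-e_i+e_j$ at rate $g_{i,N}(n_i)p_{ij,N}$, where $g_{i,N}(k)=\mu_{i,N}\mathbf 1_{\{k\ge1\}}$ for $i\in\mathcal J_1^N$ and $g_{i,N}(k)=\mu_{i,N}k$ for $i\in\mathcal J_2^N$. With utilizations $r_{j,N}=\mu_{j,N}^{-1}\theta_{j,N}$, its stationary distribution, i.e. the law of $(\xi_{1,N},\dots,\xi_{N,N})$, is $$\mathbb P(\xi_{1,N}=n_1,\dots,\xi_{N,N}=n_N)=\frac1{Z_N}\prod_{j\in\mathcal J_1^N}r_{j,N}^{n_j}\prod_{j\in\mathcal J_2^N}\frac{r_{j,N}^{n_j}}{n_j!},\qquad (n_1,\dots,n_N)\in\mathcal S_{N,M_N},$$ where $Z_N$ is the normalizing constant. $\gamma_N$ is the unique solution in $[0,\,1/\max_{j\in\mathcal J_1^N}r_{j,N})$ of $$\sum_{j\in\mathcal J_1^N}\frac{\gamma_N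 r_{j,N}}{1-\gamma_N r_{j,N}}+\sum_{j\in\mathcal J_2^N}\gamma_N r_{j,N}=M_N .$$ The free variables $\eta_{1,N},\dots,\eta_{N,N}$ are independent; for $j\in\mathcal J_1^N$, $\eta_{j,N}$ is geometric with parameter $\gamma_N r_{j,N}$, i.e. $\mathbb P(\eta_{j,N}=k)=(1-\gamma_Nr_{j,N})(\gamma_Nr_{j,N})^k$ for $k\in\mathbb N$; for $j\in\mathcal J_2^N$, $\eta_{j,N}$ is Poisson with parameter $\gamma_N r_{j,N}$. Finally $b_N\ge0$ is given by $$b_N^2=\mathrm{Var}\Big(\sum_{j=1}^N\eta_{j,N}\Big)=\sum_{j\in\mathcal J_1^N}\frac{\gamma_N r_{j,N}}{(1-\gamma_N r_{j,N})^2}+\sum_{j\in\mathcal J_2^N}\gamma_N r_{j,N}.$$ *)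

theory Defs
  imports "HOL-Probability.Probability"
begin

definition stochastic_on :: "nat set \<Rightarrow> (nat \<Rightarrow> nat \<Rightarrow> real) \<Rightarrow> bool" where
  "stochastic_on V P \<longleftrightarrow>
     (\<forall>i\<in>V. \<forall>j\<in>V. P i j \<ge> 0) \<and> (\<forall>i\<in>V. (\<Sum>j\<in>V. P i j) = 1)"

definition irreducible_on :: "nat set \<Rightarrow> (nat \<Rightarrow> nat \<Rightarrow> real) \<Rightarrow> bool" where
  "irreducible_on V P \<longleftrightarrow>
     (\<forall>i\<in>V. \<forall>j\<in>V. (i, j) \<in> {(a, b). a \<in> V \<and> b \<in> V \<and> P a b > 0}\<^sup>*)"

definition invariant_prob_vector_on ::
    "nat set \<Rightarrow> (nat \<Rightarrow> nat \<Rightarrow> real) \<Rightarrow> (nat \<Rightarrow> real) \<Rightarrow> bool" where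
  "invariant_prob_vector_on V P \<theta> \<longleftrightarrow>
     (\<forall>j\<in>V. \<theta> j \<ge> 0) \<and> (\<Sum>j\<in>V. \<theta> j) = 1 \<and> (\<forall>j\<in>V. (\<Sum>i\<in>V. \<theta> i * P i j) = \<theta> j)"

locale closed_jackson_network =
  fixes N :: nat
    and J1 J2 :: "nat set"
    and P :: "nat \<Rightarrow> nat \<Rightarrow> real"
    and \<theta> \<mu> :: "nat \<Rightarrow> real"
  assumes nodes: "J1 \<union> J2 = {1..N}" "J1 \<inter> J2 = {}" "J1 \<noteq> {}"
    and stochastic: "stochastic_on {1..N} P"
    and irreducible: "irreducible_on {1..N} P"
    and invariant: "invariant_prob_vector_on {1..N} P \<theta>"
    and service_pos: "\<And>j. j \<in> {1..N} \<Longrightarrow> \<mu> j > 0"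

text \<open>Vectors in \<open>\<nat>\<^sup>N\<close> are functions on \<^typ>\<open>nat\<close> vanishing outside \<open>{1..N}\<close>.\<close>

definition states :: "nat \<Rightarrow> nat \<Rightarrow> (nat \<Rightarrow> nat) set" where
  "states N M = {x. (\<forall>j. j \<notin> {1..N} \<longrightarrow> x j = 0) \<and> (\<Sum>j\<in>{1..N}. x j) = M}"

definition service_rate :: "nat set \<Rightarrow> (nat \<Rightarrow> real) \<Rightarrow> nat \<Rightarrow> nat \<Rightarrow> real" where
  "service_rate J1 \<mu> i k = (if i \<in> J1 then (if k \<ge> 1 then \<mu> i else 0) else \<mu> i * real k)"

text \<open>The state \<open>x - e\<^sub>i + e\<^sub>j\<close>. When \<open>x i = 0\<close> the subtraction is truncated, but then
  the service rate at \<open>i\<close> is zero.\<close>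

definition move :: "nat \<Rightarrow> nat \<Rightarrow> (nat \<Rightarrow> nat) \<Rightarrow> (nat \<Rightarrow> nat)" where
  "move i j x = (let y = x(i := x i - 1) in y(j := y j + 1))"

definition jump_rate ::
    "nat \<Rightarrow> nat set \<Rightarrow> (nat \<Rightarrow> nat \<Rightarrow> real) \<Rightarrow> (nat \<Rightarrow> real) \<Rightarrow> (nat \<Rightarrow> nat) \<Rightarrow> (nat \<Rightarrow> nat) \<Rightarrow> real" where
  "jump_rate N J1 P \<mu> x y =
     (\<Sum>i\<in>{1..N}. \<Sum>j\<in>{1..N}. if move i j x = y then service_rate J1 \<mu> i (x i) * P i j else 0)"

text \<open>The rate matrix of the occupation process: the diagonal makes the rows sum to zero, so the
  dummy moves \<open>i = j\<close>, which only contribute to \<^term>\<open>jump_rate N J1 P \<mu> x x\<close>, have no effect.\<close>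

definition generator ::
    "nat \<Rightarrow> nat set \<Rightarrow> (nat \<Rightarrow> nat \<Rightarrow> real) \<Rightarrow> (nat \<Rightarrow> real) \<Rightarrow> nat \<Rightarrow>
       (nat \<Rightarrow> nat) \<Rightarrow> (nat \<Rightarrow> nat) \<Rightarrow> real" where
  "generator N J1 P \<mu> M x y =
     (if x = y then - (\<Sum>z\<in>states N M - {x}. jump_rate N J1 P \<mu> x z) else jump_rate N J1 P \<mu> x y)"

definition stationary_distribution ::
    "nat \<Rightarrow> nat set \<Rightarrow> (nat \<Rightarrow> nat \<Rightarrow> real) \<Rightarrow> (nat \<Rightarrow> real) \<Rightarrow> nat \<Rightarrow> (nat \<Rightarrow> nat) pmf \<Rightarrow> bool" where
  "stationary_distribution N J1 P \<mu> M p \<longleftrightarrow>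
     set_pmf p \<subseteq> states N M \<and>
     (\<forall>y\<in>states N M. (\<Sum>x\<in>states N M. pmf p x * generator N J1 P \<mu> M x y) = 0)"

definition utilization :: "(nat \<Rightarrow> real) \<Rightarrow> (nat \<Rightarrow> real) \<Rightarrow> nat \<Rightarrow> real" where
  "utilization \<theta> \<mu> j = \<theta> j / \<mu> j"

definition chemical_potential ::
    "nat set \<Rightarrow> nat set \<Rightarrow> (nat \<Rightarrow> real) \<Rightarrow> nat \<Rightarrow> real \<Rightarrow> bool" where
  "chemical_potential J1 J2 r M \<gamma> \<longleftrightarrow>
     0 \<le> \<gamma> \<and> \<gamma> < 1 / Max (r ` J1) \<and>
     (\<Sum>j\<in>J1. \<gamma> * r j / (1 - \<gamma> * r j)) + (\<Sum>j\<in>J2. \<gamma> * r j) = real M"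

text \<open>\<^const>\<open>geometric_pmf\<close> is parametrised by the success probability, so its mass function
  at \<open>k\<close> is \<open>(1 - \<gamma> r\<^sub>j) (\<gamma> r\<^sub>j)\<^sup>k\<close>. \<^const>\<open>poisson_pmf\<close> is only specified for positive rates;
  \<open>\<gamma> = 0\<close> occurs for networks without customers, and the Poisson law with parameter 0 is the
  point mass at 0.\<close>

definition free_law :: "nat set \<Rightarrow> (nat \<Rightarrow> real) \<Rightarrow> real \<Rightarrow> nat \<Rightarrow> nat pmf" where
  "free_law J1 r \<gamma> j =
     (if j \<in> J1 then geometric_pmf (1 - \<gamma> * r j)
      else if \<gamma> * r j = 0 then return_pmf 0
      else poisson_pmf (\<gamma> * r j))"

text \<open>The joint law of the independent free variables.\<close>

definition free_joint_law :: "nat \<Rightarrow> nat set \<Rightarrow> (nat \<Rightarrow> real) \<Rightarrow> real \<Rightarrow> (nat \<Rightarrow> nat) pmf" where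
  "free_joint_law N J1 r \<gamma> = Pi_pmf {1..N} 0 (free_law J1 r \<gamma>)"

definition free_std_dev :: "nat \<Rightarrow> nat set \<Rightarrow> (nat \<Rightarrow> real) \<Rightarrow> real \<Rightarrow> real" where
  "free_std_dev N J1 r \<gamma> =
     sqrt (measure_pmf.variance (free_joint_law N J1 r \<gamma>) (\<lambda>x. \<Sum>j\<in>{1..N}. real (x j)))"

end

(* The product of the free marginals, restricted to the states with M_N customers, satisfies the
   balance equations, and the stationary law of the (irreducible) occupation process is unique. Hence
   xi is eta conditioned on eta_1 + ... + eta_N = M_N, and the quotient in the theorem equals
   P(eta_{K+1} + ... + eta_N = M_N - n_1 - ... - n_K) / P(eta_1 + ... + eta_N = M_N).
   Numerator and denominator are estimated by the same local limit theorem, both being asymptotic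
   to 1 / (b_N sqrt (2 pi)): the first K nodes shift the mean and the variance by o(b_N) only.
   The local limit theorem is Fourier inversion with dominated convergence. Geometric and Poisson
   laws are compound Poisson, so the logarithm of the characteristic function of a sum of free
   variables is a sum of terms a_k (e^(ikt) - 1) with a_k >= 0. This gives at once the quadratic
   approximation with a cubic error near 0 and the Gaussian bound on all of [-pi, pi]. *)

theory Submission
  imports Defs
begin

section \<open>Characteristic functions of compound Poisson laws\<close>

text \<open>The difficulty is uniformity: the free variables form a triangular array whose
  parameters vary with N, and a lattice local limit theorem needs control of the characteristic
  function away from 0 as well. Both estimates in \<open>cumulant_bounds\<close> are therefore
  relative to the variance, with constants that depend only on a bound \<rho> < 1 for the
  single-server loads; condition (1) supplies one such \<rho> for all large N. The estimates then
  add up over any set of nodes with unchanged constants. The mean of the remaining nodes has to stay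
  within o(b_N) of M_N - n_1 - ... - n_K, whereas an error o(b_N^2) in the variance would be
  harmless; this explains the power of b_N in (3). Since each free variable has mean at most its
  variance, one estimate covers both shifts: among the first K nodes, single-server ones have total
  variance at most K / (1 - \<rho>)^2, and (3) bounds the infinite-server ones.\<close>

definition cf :: "nat pmf \<Rightarrow> real \<Rightarrow> complex" where
  "cf p t = measure_pmf.expectation p (\<lambda>k. iexp (t * real k))"

text \<open>\<open>\<psi>\<close> is some logarithm of the characteristic function. Quantifying it
  existentially avoids fixing a branch, which addition of exponents need not respect.\<close>

definition cumulant_bounds :: "real \<Rightarrow> real \<Rightarrow> nat pmf \<Rightarrow> real \<Rightarrow> real \<Rightarrow> bool" where
  "cumulant_bounds C c p m v \<longleftrightarrow> (\<exists>\<psi>. \<forall>t. cf p t = exp (\<psi> t) \<and>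
     norm (\<psi> t - (\<i> * complex_of_real (t * m) - complex_of_real (t\<^sup>2 * v / 2))) \<le> C * v * \<bar>t\<bar> ^ 3 \<and>
     (\<bar>t\<bar> \<le> pi \<longrightarrow> Re (\<psi> t) \<le> - c * v * t\<^sup>2))"

text \<open>Taylor's formula gives 1 - cos t \<ge> t^2/2 - t^4/24, and t^2 \<le> 10 on the interval,
  whence 1/2 - 10/24 = 1/12.\<close>

lemma one_minus_cos_ge:
  assumes "\<bar>t\<bar> \<le> pi"
  shows "t\<^sup>2 / 12 \<le> 1 - cos (t::real)"
proof -
  have "norm (iexp t - (\<Sum>k\<le>3. (\<i> * t)^k / fact k)) \<le> \<bar>t\<bar>^4 / 24"
    using iexp_approx1[of t 3] by (simp add: eval_nat_numeral)
  then have "\<bar>Re (iexp t - (\<Sum>k\<le>3. (\<i> * t)^k / fact k))\<bar> \<le> \<bar>t\<bar>^4 / 24"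
    using abs_Re_le_cmod order_trans by blast
  moreover have "Re (iexp t - (\<Sum>k\<le>3. (\<i> * t)^k / fact k)) = cos t - (1 - t\<^sup>2 / 2)"
    by (simp add: eval_nat_numeral exp_Euler cos_of_real sin_of_real)
  moreover have "\<bar>t\<bar>^4 / 24 \<le> 10 * t\<^sup>2 / 24"
  proof -
    have "pi \<le> 3.15" using pi_approx by simp
    then have "\<bar>t\<bar>\<^sup>2 \<le> 3.15\<^sup>2" using assms by (intro power_mono) auto
    then have "\<bar>t\<bar>\<^sup>2 * \<bar>t\<bar>\<^sup>2 \<le> 10 * \<bar>t\<bar>\<^sup>2" by (intro mult_right_mono) (auto simp: power2_eq_square)
    then show ?thesis by (simp add: power4_eq_xxxx power2_eq_square mult.assoc)
  qed
  ultimately have "\<bar>cos t - (1 - t\<^sup>2 / 2)\<bar> \<le> 10 * t\<^sup>2 / 24"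
    by (simp only:)
  then show ?thesis by linarith
qed

lemma iexp_third_order: "norm (iexp x - 1 - \<i> * x + complex_of_real (x\<^sup>2 / 2)) \<le> \<bar>x\<bar> ^ 3 / 6"
  using iexp_approx1[of x 2]
  by (simp add: eval_nat_numeral algebra_simps power_mult_distrib)

text \<open>The cumulants of a compound Poisson law are the moments of its jump intensities \<open>a\<close>, and the
  unit jumps alone give the Gaussian bound.\<close>

lemma cumulant_bounds_compound_poisson:
  fixes a :: "nat \<Rightarrow> real"
  assumes nonneg: "\<And>k. 0 \<le> a k"
    and cf: "\<And>t. cf p t = exp (\<psi> t)"
    and \<psi>: "\<And>t. (\<lambda>k. complex_of_real (a k) * (iexp (t * real k) - 1)) sums \<psi> t"
    and m: "(\<lambda>k. a k * real k) sums m"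
    and v: "(\<lambda>k. a k * real k ^ 2) sums v"
    and s: "(\<lambda>k. a k * real k ^ 3) sums s"
    and C: "s \<le> 6 * C * v" and c: "12 * c * v \<le> a 1"
  shows "cumulant_bounds C c p m v"
  unfolding cumulant_bounds_def
proof (intro exI[of _ \<psi>] allI conjI impI)
  fix t :: real
  show "cf p t = exp (\<psi> t)" by (rule cf)
  let ?e = "\<lambda>k. complex_of_real (a k) * (iexp (t * real k) - 1) - (\<i> * complex_of_real (t * (a k * real k)) -
      complex_of_real (t\<^sup>2 * (a k * real k ^ 2) / 2))"
  have sums: "?e sums (\<psi> t - (\<i> * complex_of_real (t * m) - complex_of_real (t\<^sup>2 * v / 2)))"
    by (intro sums_diff \<psi> sums_mult sums_of_real sums_divide m v)
  have bd: "norm (?e k) \<le> \<bar>t\<bar> ^ 3 / 6 * (a k * real k ^ 3)" for k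
  proof -
    have "?e k = complex_of_real (a k) * (iexp (t * real k) - 1 - \<i> * (t * real k) + complex_of_real ((t * real k)\<^sup>2 / 2))"
      by (simp add: algebra_simps power_mult_distrib)
    also have "norm \<dots> \<le> a k * (\<bar>t * real k\<bar> ^ 3 / 6)"
      using mult_left_mono[OF iexp_third_order[of "t * real k"] nonneg[of k]] nonneg[of k]
      by (simp only: norm_mult norm_of_real abs_of_nonneg)
    finally show ?thesis by (simp add: abs_mult power_mult_distrib algebra_simps)
  qed
  have "norm (\<psi> t - (\<i> * complex_of_real (t * m) - complex_of_real (t\<^sup>2 * v / 2))) \<le> \<bar>t\<bar> ^ 3 / 6 * s"
    using norm_sums_le[OF sums sums_mult[OF s, of "\<bar>t\<bar> ^ 3 / 6"] bd] .
  also have "\<dots> \<le> \<bar>t\<bar> ^ 3 / 6 * (6 * C * v)" by (intro mult_left_mono C) auto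
  finally show "norm (\<psi> t - (\<i> * complex_of_real (t * m) - complex_of_real (t\<^sup>2 * v / 2))) \<le> C * v * \<bar>t\<bar> ^ 3"
    by (simp add: algebra_simps)
  show "Re (\<psi> t) \<le> - c * v * t\<^sup>2" if t: "\<bar>t\<bar> \<le> pi"
  proof -
    have "Re (complex_of_real u * (iexp x - 1)) = u * (cos x - 1)" for u x
      by (simp add: Re_exp)
    moreover have "(\<lambda>k. Re (complex_of_real (a k) * (iexp (t * real k) - 1))) sums Re (\<psi> t)"
      by (intro sums_Re \<psi>)
    ultimately have S: "(\<lambda>k. a k * (cos (t * real k) - 1)) sums Re (\<psi> t)"
      by (simp only:)
    \<comment> \<open>Every term of the series for \<open>Re (\<psi> t)\<close> is nonpositive, so
      discarding all but k = 1 can only increase the sum.\<close>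
    have "(\<lambda>k. if k = 1 then a 1 * (cos t - 1) else 0) sums (a 1 * (cos t - 1))"
      using sums_single[of 1 "\<lambda>k. a 1 * (cos t - 1)"] by simp
    with S have "Re (\<psi> t) \<le> a 1 * (cos t - 1)"
      by (rule sums_le[rotated]) (auto intro!: mult_nonneg_nonpos nonneg)
    also have "\<dots> \<le> a 1 * (- (t\<^sup>2 / 12))"
      using one_minus_cos_ge[OF t] nonneg[of 1] by (intro mult_left_mono) auto
    also have "\<dots> \<le> - c * v * t\<^sup>2" using mult_right_mono[OF c, of "t\<^sup>2 / 12"] by simp
    finally show ?thesis .
  qed
qed

section \<open>Geometric and Poisson laws as compound Poisson laws\<close>

lemma
  fixes f :: "nat \<Rightarrow> 'a :: {banach, second_countable_topology}"
  assumes "summable (\<lambda>k. pmf p k * norm (f k))"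
  shows integrable_nat_pmf: "integrable (measure_pmf p) f"
    and sums_expectation_nat_pmf: "(\<lambda>k. pmf p k *\<^sub>R f k) sums measure_pmf.expectation p f"
proof -
  have i: "integrable (count_space UNIV) (\<lambda>k. pmf p k *\<^sub>R f k)"
    using assms by (simp add: integrable_count_space_nat_iff)
  then show "integrable (measure_pmf p) f"
    unfolding measure_pmf_eq_density by (subst integrable_density) auto
  have "measure_pmf.expectation p f = (\<integral>k. pmf p k *\<^sub>R f k \<partial>count_space UNIV)"
    unfolding measure_pmf_eq_density by (subst integral_density) auto
  then show "(\<lambda>k. pmf p k *\<^sub>R f k) sums measure_pmf.expectation p f"
    using sums_integral_count_space_nat[OF i] by simp
qed

lemma summable_pmf_nat: "summable (pmf (p :: nat pmf))"
proof -
  have "integrable (count_space UNIV) (pmf p)" by (rule integrable_pmf)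
  then show ?thesis by (simp add: integrable_count_space_nat_iff)
qed

lemma cf_sums: "(\<lambda>k. complex_of_real (pmf p k) * iexp (t * real k)) sums cf p t"
proof -
  have "(\<lambda>k. pmf p k *\<^sub>R iexp (t * real k)) sums cf p t"
    unfolding cf_def by (rule sums_expectation_nat_pmf) (use summable_pmf_nat[of p] in simp)
  then show ?thesis by (simp add: scaleR_conv_of_real)
qed

text \<open>Termwise differentiation of the series of n z^n, followed by multiplication by p to
  restore the exponent.\<close>

lemma geometric_sums_times_n_squared:
  fixes p :: real
  assumes "0 \<le> p" "p < 1"
  shows "(\<lambda>k. p ^ k * real k ^ 2) sums (p * (1 + p) / (1 - p) ^ 3)"
proof -
  have 1: "(\<lambda>n. p ^ n * real n) sums (p / (1 - p)\<^sup>2)"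
    using geometric_sums_times_n[of p] assms by simp
  have 0: "(\<lambda>n. p ^ n) sums (1 / (1 - p))" using geometric_sums[of p] assms by simp
  have d: "((\<lambda>z::real. z / (1 - z)\<^sup>2) has_field_derivative ((1 + p) / (1 - p) ^ 3)) (at p)"
    using assms
    by (auto intro!: derivative_eq_intros simp: divide_simps)
       (simp add: eval_nat_numeral algebra_simps)
  have "(\<lambda>n. real n * z ^ n) sums (z / (1 - z)\<^sup>2)" if "norm z < 1" for z :: real
    using geometric_sums_times_n[of z] that by (simp add: mult.commute)
  then have "(\<lambda>n. diffs real n * p ^ n) sums ((1 + p) / (1 - p) ^ 3)"
    using assms d by (intro termdiffs_sums_strong[where K = 1]) auto
  then have "(\<lambda>n. p * (diffs real n * p ^ n)) sums (p * ((1 + p) / (1 - p) ^ 3))"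
    by (rule sums_mult)
  then have "(\<lambda>n. p ^ Suc n * real (Suc n) ^ 2) sums (p * (1 + p) / (1 - p) ^ 3)"
    by (simp add: diffs_def power2_eq_square mult_ac)
  then show ?thesis by (subst (asm) sums_Suc_iff) simp
qed

lemma cf_geometric:
  assumes "0 \<le> p" "p < 1"
  shows "cf (geometric_pmf (1 - p)) t = complex_of_real (1 - p) / (1 - complex_of_real p * iexp t)"
proof -
  let ?w = "complex_of_real p * iexp t"
  have "norm ?w < 1" using assms by (simp add: norm_mult)
  then have "(\<lambda>k. complex_of_real (1 - p) * ?w ^ k) sums (complex_of_real (1 - p) * (1 / (1 - ?w)))"
    by (intro sums_mult geometric_sums)
  moreover have "complex_of_real (1 - p) * ?w ^ k
      = complex_of_real (pmf (geometric_pmf (1 - p)) k) * iexp (t * real k)" for k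
    using assms by (simp add: power_mult_distrib exp_of_nat_mult[symmetric] mult_ac)
  ultimately show ?thesis
    using cf_sums[of "geometric_pmf (1 - p)" t] sums_unique2 by fastforce
qed

text \<open>Expanding both logarithms in ln(1 - p) - ln(1 - p e^(it)) shows that the jump
  intensities are p^k / k. The third cumulant is v (1 + p) / (1 - p) \<le> 2 v / (1 - \<rho>), which
  dictates C; the unit intensity is p = (1 - p)^2 v \<ge> (1 - \<rho>)^2 v, which dictates
  c.\<close>

lemma cumulant_bounds_geometric:
  assumes p: "0 \<le> p" "p \<le> \<rho>" and \<rho>: "\<rho> < 1"
  shows "cumulant_bounds (1 / (3 * (1 - \<rho>))) ((1 - \<rho>)\<^sup>2 / 12) (geometric_pmf (1 - p)) (p / (1 - p)) (p / (1 - p)\<^sup>2)"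
proof (rule cumulant_bounds_compound_poisson)
  from p \<rho> have p1: "p < 1" by simp
  let ?a = "\<lambda>k. p ^ k / real k"
  let ?\<psi> = "\<lambda>t. ln (1 - complex_of_real p) - ln (1 - complex_of_real p * iexp t)"
  show "0 \<le> ?a k" for k using p by simp
  show "cf (geometric_pmf (1 - p)) t = exp (?\<psi> t)" for t
  proof -
    have "norm (complex_of_real p * iexp t) < 1" using p p1 by (simp add: norm_mult)
    then have "1 - complex_of_real p * iexp t \<noteq> 0" by auto
    moreover have "1 - complex_of_real p \<noteq> 0" using p1 by (metis less_irrefl of_real_1 of_real_eq_iff right_minus_eq)
    ultimately show ?thesis using p p1 by (simp add: cf_geometric exp_diff)
  qed
  show "(\<lambda>k. complex_of_real (?a k) * (iexp (t * real k) - 1)) sums ?\<psi> t" for t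
  proof -
    have n: "norm (- complex_of_real p) < 1" "norm (- (complex_of_real p * iexp t)) < 1"
      using p p1 by (auto simp: norm_mult)
    from sums_diff[OF Ln_series'[OF n(1)] Ln_series'[OF n(2)]]
    have "(\<lambda>k. - (complex_of_real p ^ k) / of_nat k - - ((complex_of_real p * iexp t) ^ k) / of_nat k) sums ?\<psi> t"
      by simp
    \<comment> \<open>At k = 0 both sides are 0, because division by zero yields 0.\<close>
    moreover have "- (complex_of_real p ^ k) / of_nat k - - ((complex_of_real p * iexp t) ^ k) / of_nat k
       = complex_of_real (?a k) * (iexp (t * real k) - 1)" for k
      by (cases "k = 0") (simp_all add: power_mult_distrib exp_of_nat_mult[symmetric] field_simps)
    ultimately show ?thesis by (simp only:)
  qed
  have "(\<lambda>n. p ^ Suc n) sums (p * (1 / (1 - p)))"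
    using sums_mult[OF geometric_sums[of p], of p] p p1 by simp
  then have "(\<lambda>k. if k = 0 then 0 else p ^ k) sums (p / (1 - p))"
    using sums_Suc_iff[of "\<lambda>k. if k = 0 then 0 else p ^ k" "p / (1 - p)"] by simp
  also have "(\<lambda>k. if k = 0 then 0 else p ^ k) = (\<lambda>k. ?a k * real k)" by auto
  finally show "(\<lambda>k. ?a k * real k) sums (p / (1 - p))" .
  have "(\<lambda>k. p ^ k * real k) = (\<lambda>k. ?a k * real k ^ 2)" by (auto simp: power2_eq_square)
  then show "(\<lambda>k. ?a k * real k ^ 2) sums (p / (1 - p)\<^sup>2)"
    using geometric_sums_times_n[of p] p p1 by simp
  have "(\<lambda>k. p ^ k * real k ^ 2) = (\<lambda>k. ?a k * real k ^ 3)" by (auto simp: power2_eq_square power3_eq_cube)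
  then show "(\<lambda>k. ?a k * real k ^ 3) sums (p * (1 + p) / (1 - p) ^ 3)"
    using geometric_sums_times_n_squared[of p] p p1 by simp
  have "p * (1 + p) / (1 - p) ^ 3 = p / (1 - p)\<^sup>2 * ((1 + p) / (1 - p))"
    by (simp add: power2_eq_square power3_eq_cube)
  also have "\<dots> \<le> p / (1 - p)\<^sup>2 * (2 / (1 - \<rho>))"
    using p p1 \<rho> by (intro mult_left_mono frac_le) auto
  also have "2 / (1 - \<rho>) = 6 * (1 / (3 * (1 - \<rho>)))"
    using \<rho> by (simp add: divide_simps)
  finally show "p * (1 + p) / (1 - p) ^ 3 \<le> 6 * (1 / (3 * (1 - \<rho>))) * (p / (1 - p)\<^sup>2)"
    by (simp only: mult.commute)
  have "(1 - \<rho>)\<^sup>2 * p \<le> (1 - p)\<^sup>2 * p"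
    using p \<rho> by (intro mult_right_mono power_mono) auto
  then show "12 * ((1 - \<rho>)\<^sup>2 / 12) * (p / (1 - p)\<^sup>2) \<le> ?a 1"
    using p1 by (simp add: field_simps)
qed

lemma cf_poisson:
  assumes "0 < l"
  shows "cf (poisson_pmf l) t = exp (complex_of_real l * (iexp t - 1))"
proof -
  let ?w = "complex_of_real l * iexp t"
  have "(\<lambda>k. complex_of_real (exp (- l)) * (?w ^ k /\<^sub>R fact k)) sums (complex_of_real (exp (- l)) * exp ?w)"
    by (intro sums_mult exp_converges)
  moreover have "complex_of_real (exp (- l)) * (?w ^ k /\<^sub>R fact k)
      = complex_of_real (pmf (poisson_pmf l) k) * iexp (t * real k)" for k
    using assms by (simp add: power_mult_distrib exp_of_nat_mult[symmetric] scaleR_conv_of_real field_simps)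
  moreover have "complex_of_real (exp (- l)) * exp ?w = exp (complex_of_real l * (iexp t - 1))"
    by (simp add: right_diff_distrib exp_diff exp_minus exp_of_real field_simps)
  ultimately show ?thesis
    using cf_sums[of "poisson_pmf l" t] sums_unique2 by fastforce
qed

text \<open>All jumps have size 1, so the unit intensity and the first three cumulants equal l. The
  constants are those of the geometric case, weaker than possible here, so that both kinds of node
  can be summed together.\<close>

lemma cumulant_bounds_poisson:
  assumes l: "0 < l" and \<rho>: "0 \<le> \<rho>" "\<rho> < 1"
  shows "cumulant_bounds (1 / (3 * (1 - \<rho>))) ((1 - \<rho>)\<^sup>2 / 12) (poisson_pmf l) l l"
proof (rule cumulant_bounds_compound_poisson)
  let ?a = "\<lambda>k::nat. if k = 1 then l else 0"
  show "0 \<le> ?a k" for k using l by simp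
  show "cf (poisson_pmf l) t = exp (complex_of_real l * (iexp t - 1))" for t
    by (rule cf_poisson[OF l])
  have "(\<lambda>k. if k = 1 then complex_of_real l * (iexp (t * real k) - 1) else 0) sums (complex_of_real l * (iexp (t * real 1) - 1))" for t
    by (rule sums_single)
  moreover have "(\<lambda>k. complex_of_real (?a k) * (iexp (t * real k) - 1))
     = (\<lambda>k. if k = 1 then complex_of_real l * (iexp (t * real k) - 1) else 0)" for t
    by auto
  ultimately show "(\<lambda>k. complex_of_real (?a k) * (iexp (t * real k) - 1)) sums (complex_of_real l * (iexp t - 1))" for t
    by simp
  have *: "?a = (\<lambda>k. ?a k * real k)" "?a = (\<lambda>k. ?a k * real k ^ 2)" "?a = (\<lambda>k. ?a k * real k ^ 3)" by auto
  have S: "?a sums l" using sums_single[of 1 "\<lambda>_. l"] by simp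
  show "(\<lambda>k. ?a k * real k) sums l" using S *(1) by simp
  show "(\<lambda>k. ?a k * real k ^ 2) sums l" using S *(2) by simp
  show "(\<lambda>k. ?a k * real k ^ 3) sums l" using S *(3) by simp
  show "l \<le> 6 * (1 / (3 * (1 - \<rho>))) * l" using l \<rho> by (simp add: field_simps)
  have "(1 - \<rho>)\<^sup>2 \<le> 1\<^sup>2" using \<rho> by (intro power_mono) auto
  then show "12 * ((1 - \<rho>)\<^sup>2 / 12) * l \<le> ?a 1" using l by simp
qed

text \<open>The raw second moment is what the series computations deliver. Integrability is recorded
  because a Bochner expectation alone would be 0 by convention if it failed.\<close>

definition has_moments :: "nat pmf \<Rightarrow> real \<Rightarrow> real \<Rightarrow> bool" where
  "has_moments p m v \<longleftrightarrow> integrable (measure_pmf p) (\<lambda>k. real k) \<and> integrable (measure_pmf p) (\<lambda>k. (real k)\<^sup>2) \<and>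
     measure_pmf.expectation p real = m \<and> measure_pmf.expectation p (\<lambda>k. (real k)\<^sup>2) = v + m\<^sup>2"

lemma has_momentsI:
  assumes "(\<lambda>k. pmf p k * real k) sums m" "(\<lambda>k. pmf p k * (real k)\<^sup>2) sums (v + m\<^sup>2)"
  shows "has_moments p m v"
proof -
  have 1: "summable (\<lambda>k. pmf p k * norm (real k))" "summable (\<lambda>k. pmf p k * norm ((real k)\<^sup>2))"
    using assms by (auto simp: sums_iff)
  show ?thesis unfolding has_moments_def
    using integrable_nat_pmf[OF 1(1)] integrable_nat_pmf[OF 1(2)]
      sums_expectation_nat_pmf[OF 1(1)] sums_expectation_nat_pmf[OF 1(2)] assms
    by (auto dest: sums_unique2)
qed

lemma has_moments_geometric:
  assumes "0 \<le> p" "p < 1"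
  shows "has_moments (geometric_pmf (1 - p)) (p / (1 - p)) (p / (1 - p)\<^sup>2)"
proof (rule has_momentsI)
  have "(\<lambda>k. (1 - p) * (p ^ k * real k)) sums ((1 - p) * (p / (1 - p)\<^sup>2))"
    using geometric_sums_times_n[of p] assms by (intro sums_mult) auto
  also have "(1 - p) * (p / (1 - p)\<^sup>2) = p / (1 - p)" using assms by (simp add: power2_eq_square)
  finally show "(\<lambda>k. pmf (geometric_pmf (1 - p)) k * real k) sums (p / (1 - p))"
    using assms by (simp add: mult_ac)
  have "(\<lambda>k. (1 - p) * (p ^ k * (real k)\<^sup>2)) sums ((1 - p) * (p * (1 + p) / (1 - p) ^ 3))"
    by (intro sums_mult geometric_sums_times_n_squared assms)
  also have "(1 - p) * (p * (1 + p) / (1 - p) ^ 3) = p / (1 - p)\<^sup>2 + (p / (1 - p))\<^sup>2"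
    using assms by (simp add: power2_eq_square power3_eq_cube divide_simps) (simp add: algebra_simps)
  finally show "(\<lambda>k. pmf (geometric_pmf (1 - p)) k * (real k)\<^sup>2) sums (p / (1 - p)\<^sup>2 + (p / (1 - p))\<^sup>2)"
    using assms by (simp add: mult_ac)
qed

lemma has_moments_poisson:
  assumes l: "0 < l"
  shows "has_moments (poisson_pmf l) l l"
proof (rule has_momentsI)
  let ?q = "pmf (poisson_pmf l)"
  have E: "(\<lambda>k. exp (- l) * (l ^ k /\<^sub>R fact k)) sums (exp (- l) * exp l)"
    by (intro sums_mult exp_converges)
  also have "(\<lambda>k. exp (- l) * (l ^ k /\<^sub>R fact k)) = ?q"
    using l by (auto simp: field_simps)
  finally have E: "?q sums 1" by (simp add: exp_minus)
  have 1: "(\<lambda>k. l * ?q k) sums (l * 1)" by (intro sums_mult E)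
  \<comment> \<open>This recurrence reduces each moment series to a shifted one of lower order; the
    terms at k = 0 vanish, so the shift costs nothing.\<close>
  have step: "?q (Suc k) * real (Suc k) = l * ?q k" for k
    using l by (simp add: fact_Suc del: of_nat_Suc)
  with 1 show 2: "(\<lambda>k. ?q k * real k) sums l"
    using sums_Suc_iff[of "\<lambda>k. ?q k * real k" l] by (simp del: pmf_poisson of_nat_Suc)
  have 3: "(\<lambda>k. l * (?q k * real k) + l * ?q k) sums (l * l + l * 1)"
    by (intro sums_add sums_mult 2 E)
  have "?q (Suc k) * (real (Suc k))\<^sup>2 = l * (?q k * real k) + l * ?q k" for k
  proof -
    have "?q (Suc k) * (real (Suc k))\<^sup>2 = (?q (Suc k) * real (Suc k)) * real (Suc k)"
      by (simp only: power2_eq_square mult.assoc)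
    also have "?q (Suc k) * real (Suc k) = l * ?q k" by (rule step)
    finally show ?thesis by (simp add: algebra_simps del: pmf_poisson)
  qed
  with 3 show "(\<lambda>k. ?q k * (real k)\<^sup>2) sums (l + l\<^sup>2)"
    using sums_Suc_iff[of "\<lambda>k. ?q k * (real k)\<^sup>2" "l * l + l * 1"]
    by (simp del: pmf_poisson of_nat_Suc add: power2_eq_square add.commute)
qed

section \<open>Sums of independent variables\<close>

lemma
  fixes f :: "'i \<Rightarrow> 'b \<Rightarrow> 'c :: {real_normed_field, second_countable_topology, banach}"
  assumes fin: "finite A" and i: "i \<in> A"
  shows expectation_Pi_pmf_component:
      "measure_pmf.expectation (Pi_pmf A d p) (\<lambda>h. f i (h i)) = measure_pmf.expectation (p i) (f i)"
    and integrable_Pi_pmf_component: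
      "integrable (measure_pmf (p i)) (f i) \<Longrightarrow> integrable (measure_pmf (Pi_pmf A d p)) (\<lambda>h. f i (h i))"
proof -
  have "map_pmf (\<lambda>h. h i) (Pi_pmf A d p) = p i"
    using Pi_pmf_component[OF fin, of i d p] i by simp
  then have *: "p i = map_pmf (\<lambda>h. h i) (Pi_pmf A d p)" ..
  show "measure_pmf.expectation (Pi_pmf A d p) (\<lambda>h. f i (h i)) = measure_pmf.expectation (p i) (f i)"
    by (subst *) simp
  show "integrable (measure_pmf (Pi_pmf A d p)) (\<lambda>h. f i (h i))" if "integrable (measure_pmf (p i)) (f i)"
    using that by (subst (asm) *) (simp add: integrable_map_pmf_eq)
qed

text \<open>The generality in the field serves two uses: complex exponentials for characteristic
  functions and real centred variables for covariances.\<close>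

lemma expectation_prod_Pi_pmf_field:
  fixes f :: "'i \<Rightarrow> 'b \<Rightarrow> 'c :: {real_normed_field, second_countable_topology, banach}"
  assumes fin: "finite A" and int: "\<And>i. i \<in> A \<Longrightarrow> integrable (measure_pmf (p i)) (f i)"
  shows "measure_pmf.expectation (Pi_pmf A d p) (\<lambda>h. \<Prod>i\<in>A. f i (h i)) =
    (\<Prod>i\<in>A. measure_pmf.expectation (p i) (f i))"
proof -
  have "prob_space.indep_vars (measure_pmf (Pi_pmf A d p)) (\<lambda>_. borel) (\<lambda>i h. f i (h i)) A"
    by (rule prob_space.indep_vars_compose2[OF measure_pmf.prob_space_axioms indep_vars_Pi_pmf[OF fin]]) simp
  then have "measure_pmf.expectation (Pi_pmf A d p) (\<lambda>h. \<Prod>i\<in>A. f i (h i)) =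
     (\<Prod>i\<in>A. measure_pmf.expectation (Pi_pmf A d p) (\<lambda>h. f i (h i)))"
    by (intro prob_space.indep_vars_lebesgue_integral[OF measure_pmf.prob_space_axioms fin])
       (auto intro!: integrable_Pi_pmf_component fin int)
  also have "\<dots> = (\<Prod>i\<in>A. measure_pmf.expectation (p i) (f i))"
    by (intro prod.cong refl expectation_Pi_pmf_component fin)
  finally show ?thesis .
qed

definition sum_law :: "'i set \<Rightarrow> ('i \<Rightarrow> nat pmf) \<Rightarrow> nat pmf" where
  "sum_law A F = map_pmf (\<lambda>h. \<Sum>j\<in>A. h j) (Pi_pmf A 0 F)"

lemma cf_sum_law:
  assumes "finite A"
  shows "cf (sum_law A F) t = (\<Prod>j\<in>A. cf (F j) t)"
proof -
  have "cf (sum_law A F) t = measure_pmf.expectation (Pi_pmf A 0 F) (\<lambda>h. \<Prod>j\<in>A. iexp (t * real (h j)))"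
    using assms by (simp add: cf_def sum_law_def exp_sum[symmetric] sum_distrib_left)
  also have "\<dots> = (\<Prod>j\<in>A. cf (F j) t)"
    unfolding cf_def
    by (rule expectation_prod_Pi_pmf_field[OF assms]) (auto intro!: measure_pmf.integrable_const_bound[where B = 1])
  finally show ?thesis .
qed

lemma cumulant_bounds_sum_law:
  assumes fin: "finite A" and bd: "\<And>j. j \<in> A \<Longrightarrow> cumulant_bounds C c (F j) (m j) (v j)"
  shows "cumulant_bounds C c (sum_law A F) (\<Sum>j\<in>A. m j) (\<Sum>j\<in>A. v j)"
proof -
  from bd have "\<forall>j\<in>A. \<exists>\<psi>. \<forall>t. cf (F j) t = exp (\<psi> t) \<and>
     norm (\<psi> t - (\<i> * complex_of_real (t * m j) - complex_of_real (t\<^sup>2 * v j / 2))) \<le> C * v j * \<bar>t\<bar> ^ 3 \<and>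
     (\<bar>t\<bar> \<le> pi \<longrightarrow> Re (\<psi> t) \<le> - c * v j * t\<^sup>2)"
    unfolding cumulant_bounds_def by blast
  then obtain \<psi> where \<psi>: "\<And>j t. j \<in> A \<Longrightarrow> cf (F j) t = exp (\<psi> j t)"
     "\<And>j t. j \<in> A \<Longrightarrow> norm (\<psi> j t - (\<i> * complex_of_real (t * m j) - complex_of_real (t\<^sup>2 * v j / 2))) \<le> C * v j * \<bar>t\<bar> ^ 3"
     "\<And>j t. j \<in> A \<Longrightarrow> \<bar>t\<bar> \<le> pi \<Longrightarrow> Re (\<psi> j t) \<le> - c * v j * t\<^sup>2"
    by metis
  show ?thesis unfolding cumulant_bounds_def
  proof (intro exI[of _ "\<lambda>t. \<Sum>j\<in>A. \<psi> j t"] allI conjI impI)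
    fix t
    show "cf (sum_law A F) t = exp (\<Sum>j\<in>A. \<psi> j t)"
      using \<psi>(1) by (simp add: cf_sum_law fin exp_sum)
    have "norm (\<Sum>j\<in>A. \<psi> j t - (\<i> * complex_of_real (t * m j) - complex_of_real (t\<^sup>2 * v j / 2))) \<le> (\<Sum>j\<in>A. C * v j * \<bar>t\<bar> ^ 3)"
      by (intro sum_norm_le \<psi>(2))
    moreover have "(\<Sum>j\<in>A. \<psi> j t) - (\<i> * complex_of_real (t * (\<Sum>j\<in>A. m j)) - complex_of_real (t\<^sup>2 * (\<Sum>j\<in>A. v j) / 2))
       = (\<Sum>j\<in>A. \<psi> j t - (\<i> * complex_of_real (t * m j) - complex_of_real (t\<^sup>2 * v j / 2)))"
      by (simp add: sum_subtractf sum_distrib_left sum_divide_distrib)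
    ultimately show "norm ((\<Sum>j\<in>A. \<psi> j t) - (\<i> * complex_of_real (t * (\<Sum>j\<in>A. m j)) - complex_of_real (t\<^sup>2 * (\<Sum>j\<in>A. v j) / 2))) \<le> C * (\<Sum>j\<in>A. v j) * \<bar>t\<bar> ^ 3"
      by (simp add: sum_distrib_left sum_distrib_right)
    assume "\<bar>t\<bar> \<le> pi"
    then have "(\<Sum>j\<in>A. Re (\<psi> j t)) \<le> (\<Sum>j\<in>A. - c * v j * t\<^sup>2)"
      by (intro sum_mono \<psi>(3))
    then show "Re (\<Sum>j\<in>A. \<psi> j t) \<le> - c * (\<Sum>j\<in>A. v j) * t\<^sup>2"
      by (simp add: sum_distrib_left sum_distrib_right sum_negf)
  qed
qed

lemma variance_sum_Pi_pmf:
  assumes fin: "finite A" and mom: "\<And>j. j \<in> A \<Longrightarrow> has_moments (F j) (m j) (v j)"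
  shows "measure_pmf.variance (Pi_pmf A 0 F) (\<lambda>x. \<Sum>j\<in>A. real (x j)) = (\<Sum>j\<in>A. v j)"
proof -
  let ?P = "Pi_pmf A 0 F"
  let ?E = "measure_pmf.expectation ?P"
  have mom': "integrable (F j) real" "integrable (F j) (\<lambda>k. (real k)\<^sup>2)"
    "measure_pmf.expectation (F j) real = m j" "measure_pmf.expectation (F j) (\<lambda>k. (real k)\<^sup>2) = v j + (m j)\<^sup>2"
    if "j \<in> A" for j using mom[OF that] by (auto simp: has_moments_def)
  define X where "X j x = real x - m j" for j x
  have X2: "(X j x)\<^sup>2 = (real x)\<^sup>2 - 2 * m j * real x + (m j)\<^sup>2" for j x
    by (simp add: X_def power2_eq_square algebra_simps)
  have intX: "integrable (F j) (X j)" "integrable (F j) (\<lambda>x. (X j x)\<^sup>2)"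
    and EX: "measure_pmf.expectation (F j) (X j) = 0" "measure_pmf.expectation (F j) (\<lambda>x. (X j x)\<^sup>2) = v j" if "j \<in> A" for j
    using mom'[OF that] by (simp_all only: X2) (simp_all add: X_def[abs_def] power2_eq_square)
  have m1: "?E (\<lambda>x. \<Sum>j\<in>A. real (x j)) = (\<Sum>j\<in>A. m j)"
  proof -
    have "?E (\<lambda>x. \<Sum>j\<in>A. real (x j)) = (\<Sum>j\<in>A. ?E (\<lambda>x. real (x j)))"
      by (intro Bochner_Integration.integral_sum integrable_Pi_pmf_component fin mom')
    also have "\<dots> = (\<Sum>j\<in>A. m j)"
      using mom' expectation_Pi_pmf_component[OF fin, where f = "\<lambda>_. real"] by (intro sum.cong) simp_all
    finally show ?thesis .
  qed
  have cross: "integrable ?P (\<lambda>x. X i (x i) * X j (x j)) \<and> ?E (\<lambda>x. X i (x i) * X j (x j)) = (if i = j then v i else 0)"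
    if i: "i \<in> A" and j: "j \<in> A" for i j
  proof (cases "i = j")
    case True
    then show ?thesis
      using expectation_Pi_pmf_component[OF fin j, of 0 F "\<lambda>j x. (X j x)\<^sup>2"] EX[OF j]
        integrable_Pi_pmf_component[OF fin j, of F "\<lambda>j x. (X j x)\<^sup>2" 0] intX[OF j]
      by (simp add: power2_eq_square)
  next
    case False
    \<comment> \<open>Padding with factors 1 turns the product of two centred variables into a
      product over all of \<open>A\<close>, to which independence applies; the factor at i has
      expectation 0.\<close>
    let ?f = "\<lambda>k x. if k = i \<or> k = j then X k x else 1"
    have int: "integrable (F k) (?f k)" if "k \<in> A" for k using intX[OF that] by (cases "k = i \<or> k = j") simp_all
    have "(\<Prod>k\<in>A. ?f k (x k)) = X i (x i) * X j (x j)" for x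
    proof -
      have "(\<Prod>k\<in>A. ?f k (x k)) = (\<Prod>k\<in>{i, j}. ?f k (x k))"
        using i j fin by (intro prod.mono_neutral_right) auto
      then show ?thesis using False by simp
    qed
    moreover have "(\<Prod>k\<in>A. measure_pmf.expectation (F k) (?f k)) = 0"
      using i fin EX[OF i] by (auto intro!: bexI[of _ i])
    ultimately show ?thesis
      using expectation_prod_Pi_pmf_field[OF fin, of F ?f 0] integrable_prod_Pi_pmf[OF fin, of F ?f 0] int False
      by simp
  qed
  have "measure_pmf.variance ?P (\<lambda>x. \<Sum>j\<in>A. real (x j)) = ?E (\<lambda>x. (\<Sum>j\<in>A. X j (x j))\<^sup>2)"
    by (simp add: m1 X_def sum_subtractf)
  also have "\<dots> = ?E (\<lambda>x. \<Sum>i\<in>A. \<Sum>j\<in>A. X i (x i) * X j (x j))"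
    by (simp add: power2_eq_square sum_product)
  also have "\<dots> = (\<Sum>i\<in>A. \<Sum>j\<in>A. ?E (\<lambda>x. X i (x i) * X j (x j)))"
  proof -
    have "?E (\<lambda>x. \<Sum>i\<in>A. \<Sum>j\<in>A. X i (x i) * X j (x j)) = (\<Sum>i\<in>A. ?E (\<lambda>x. \<Sum>j\<in>A. X i (x i) * X j (x j)))"
      by (intro Bochner_Integration.integral_sum Bochner_Integration.integrable_sum cross[THEN conjunct1])
    also have "\<dots> = (\<Sum>i\<in>A. \<Sum>j\<in>A. ?E (\<lambda>x. X i (x i) * X j (x j)))"
      by (intro sum.cong refl Bochner_Integration.integral_sum cross[THEN conjunct1])
    finally show ?thesis .
  qed
  also have "\<dots> = (\<Sum>i\<in>A. \<Sum>j\<in>A. if i = j then v i else 0)"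
    using cross by (intro sum.cong refl) auto
  also have "\<dots> = (\<Sum>j\<in>A. v j)" using fin by simp
  finally show ?thesis .
qed

section \<open>The local limit theorem\<close>

lemma integral_iexp_period:
  fixes d :: int
  shows "(\<integral>t. indicator {-pi..pi} t *\<^sub>R iexp (t * of_int d) \<partial>lborel) = (if d = 0 then 2 * complex_of_real pi else 0)"
proof (cases "d = 0")
  case True
  then show ?thesis using integral_FTC_atLeastAtMost[of "-pi" pi "\<lambda>t. complex_of_real t" "\<lambda>_. 1"]
    by (auto intro!: derivative_eq_intros has_vector_derivative_real_field simp: scaleR_conv_of_real)
next
  case False
  let ?F = "\<lambda>t. iexp (t * of_int d) / (\<i> * of_int d)"
  have "(\<integral>t. indicator {-pi..pi} t *\<^sub>R iexp (t * of_int d) \<partial>lborel) = ?F pi - ?F (- pi)"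
  proof (rule integral_FTC_atLeastAtMost)
    show "(?F has_vector_derivative iexp (t * of_int d)) (at t within {- pi..pi})" for t
      using False
      by (auto intro!: derivative_eq_intros has_vector_derivative_real_field simp: field_simps)
    show "continuous_on {- pi..pi} (\<lambda>t. iexp (t * real_of_int d))"
      by (intro continuous_intros)
  qed simp
  also have "iexp (pi * of_int d) = iexp (- pi * of_int d)"
  proof -
    have "iexp (pi * of_int d) = iexp (- pi * of_int d) * exp (\<i> * (of_int d * (of_real pi * 2)))"
      by (simp add: exp_add[symmetric] algebra_simps del: exp_2pi_1_int)
    then show ?thesis by (simp only: exp_2pi_1_int mult_1_right)
  qed
  finally show ?thesis using False by simp
qed

text \<open>The parameter t sits inside an expectation; the series exhibits \<open>cf p\<close> as a
  pointwise limit of measurable functions.\<close>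

lemma cf_measurable [measurable]: "cf p \<in> borel_measurable borel"
proof -
  have "cf p = (\<lambda>t. \<Sum>k. complex_of_real (pmf p k) * iexp (t * real k))"
    using cf_sums sums_unique by blast
  then show ?thesis by simp
qed

lemma pmf_inversion:
  "2 * pi * complex_of_real (pmf p k) = (\<integral>t. indicator {-pi..pi} t *\<^sub>R (cf p t * iexp (- t * real k)) \<partial>lborel)"
proof -
  let ?f = "\<lambda>i t. complex_of_real (pmf p i) * (indicator {-pi..pi} t *\<^sub>R iexp (t * of_int (int i - int k)))"
  have int: "integrable lborel (?f i)" for i
  proof -
    have "continuous_on {-pi..pi} (\<lambda>t. iexp (t * of_int (int i - int k)))"
      by (intro continuous_intros)
    from borel_integrable_atLeastAtMost'[OF this] show ?thesis
      unfolding set_integrable_def by (rule integrable_mult_right)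
  qed
  have n: "norm (?f i t) = pmf p i * indicator {-pi..pi} t" for i t
    by (simp add: norm_mult)
  have sums: "(\<lambda>i. ?f i t) sums (indicator {-pi..pi} t *\<^sub>R (cf p t * iexp (- t * real k)))" for t
  proof -
    have "(\<lambda>i. indicator {-pi..pi} t *\<^sub>R ((complex_of_real (pmf p i) * iexp (t * real i)) * iexp (- t * real k)))
       sums (indicator {-pi..pi} t *\<^sub>R (cf p t * iexp (- t * real k)))"
      by (intro sums_scaleR_right sums_mult2 cf_sums)
    moreover have "indicator {-pi..pi} t *\<^sub>R ((complex_of_real (pmf p i) * iexp (t * real i)) * iexp (- t * real k)) = ?f i t" for i
      by (simp add: exp_add[symmetric] algebra_simps indicator_def)
    ultimately show ?thesis by (simp only:)
  qed
  \<comment> \<open>Sum and integral may be exchanged because the i-th term is bounded by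
    \<open>pmf p i\<close> on a bounded interval. Orthogonality then leaves only i = k.\<close>
  have "(\<lambda>i. integral\<^sup>L lborel (?f i)) sums (\<integral>t. (\<Sum>i. ?f i t) \<partial>lborel)"
  proof (rule sums_integral[where f = ?f])
    show "integrable lborel (?f i)" for i by (rule int)
    show "AE t in lborel. summable (\<lambda>i. norm (?f i t))"
      unfolding n by (simp add: summable_mult2 summable_pmf_nat)
    show "summable (\<lambda>i. \<integral>t. norm (?f i t) \<partial>lborel)"
      unfolding n by (simp add: summable_mult2 summable_pmf_nat)
  qed
  moreover have "(\<lambda>t. \<Sum>i. ?f i t) = (\<lambda>t. indicator {-pi..pi} t *\<^sub>R (cf p t * iexp (- t * real k)))"
    using sums_unique[OF sums] by (auto simp only: fun_eq_iff)
  moreover have "integral\<^sup>L lborel (?f i) = (if i = k then 2 * pi * complex_of_real (pmf p k) else 0)" for i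
    by (simp only: integral_mult_right_zero integral_iexp_period) auto
  ultimately have "(\<lambda>i. if i = k then 2 * pi * complex_of_real (pmf p k) else 0) sums
     (\<integral>t. indicator {-pi..pi} t *\<^sub>R (cf p t * iexp (- t * real k)) \<partial>lborel)"
    by simp
  then show ?thesis using sums_single[of k "\<lambda>_. 2 * pi * complex_of_real (pmf p k)"] sums_unique2 by blast
qed

lemma integrable_exp_square:
  assumes "0 < c"
  shows "integrable lborel (\<lambda>x::real. exp (- c * x\<^sup>2))"
proof -
  \<comment> \<open>The standard deviation for which the centred normal density is proportional to
    exp (- c x^2).\<close>
  let ?s = "sqrt (1 / (2 * c))"
  have "integrable lborel (\<lambda>x. sqrt (2 * pi * ?s\<^sup>2) * (normal_density 0 ?s x * (x - 0) ^ 0))"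
    using assms by (intro integrable_mult_right integrable_normal_moment) simp
  then show ?thesis using assms by (simp add: normal_density_def mult_ac)
qed

lemma integral_exp_half_square: "(\<integral>x. exp (- x\<^sup>2 / 2) \<partial>lborel) = sqrt (2 * pi)"
proof -
  have "(\<integral>x. std_normal_density x \<partial>lborel) = 1"
    using integral_std_normal_moment_even[of 0] by simp
  then show ?thesis by (simp add: std_normal_density_def field_simps)
qed

lemma local_limit_theorem:
  fixes q :: "nat \<Rightarrow> nat pmf"
  assumes bd: "\<And>N. cumulant_bounds C c (q N) (m N) (v N)" and c: "0 < c"
    and v_pos: "\<And>N. 0 < v N" and v: "filterlim v at_top sequentially"
    and k: "(\<lambda>N. (real (k N) - m N) / sqrt (v N)) \<longlonglongrightarrow> 0"
  shows "(\<lambda>N. sqrt (v N) * pmf (q N) (k N)) \<longlonglongrightarrow> 1 / sqrt (2 * pi)"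
proof -
  define \<sigma> where "\<sigma> N = sqrt (v N)" for N
  have \<sigma>: "0 < \<sigma> N" "(\<sigma> N)\<^sup>2 = v N" for N using v_pos[of N] by (auto simp: \<sigma>_def)
  have \<sigma>_inf: "filterlim \<sigma> at_top sequentially"
    unfolding \<sigma>_def by (rule filterlim_compose[OF sqrt_at_top v])
  from bd have "\<forall>N. \<exists>\<psi>. \<forall>t. cf (q N) t = exp (\<psi> t) \<and>
     norm (\<psi> t - (\<i> * complex_of_real (t * m N) - complex_of_real (t\<^sup>2 * v N / 2))) \<le> C * v N * \<bar>t\<bar> ^ 3 \<and>
     (\<bar>t\<bar> \<le> pi \<longrightarrow> Re (\<psi> t) \<le> - c * v N * t\<^sup>2)"
    unfolding cumulant_bounds_def by blast
  then obtain \<psi> where \<psi>: "\<And>N t. cf (q N) t = exp (\<psi> N t)"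
     "\<And>N t. norm (\<psi> N t - (\<i> * complex_of_real (t * m N) - complex_of_real (t\<^sup>2 * v N / 2))) \<le> C * v N * \<bar>t\<bar> ^ 3"
     "\<And>N t. \<bar>t\<bar> \<le> pi \<Longrightarrow> Re (\<psi> N t) \<le> - c * v N * t\<^sup>2"
    by metis
  define g where "g N t = indicator {-pi..pi} t *\<^sub>R (cf (q N) t * iexp (- t * real (k N)))" for N t
  have inv: "complex_of_real (2 * pi * (\<sigma> N * pmf (q N) (k N))) = (\<integral>u. g N (u / \<sigma> N) \<partial>lborel)" for N
  proof -
    have "2 * pi * complex_of_real (pmf (q N) (k N)) = integral\<^sup>L lborel (g N)"
      unfolding g_def by (rule pmf_inversion)
    \<comment> \<open>Substitution t = u / \<sigma>: it produces the factor \<sigma> of the claim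
      and makes the integrand converge for fixed u.\<close>
    also have "\<dots> = \<bar>1 / \<sigma> N\<bar> *\<^sub>R (\<integral>u. g N (0 + 1 / \<sigma> N * u) \<partial>lborel)"
      using \<sigma>(1)[of N] by (intro lborel_integral_real_affine) simp
    finally show ?thesis using \<sigma>(1)[of N] by (simp add: scaleR_conv_of_real field_simps)
  qed
  have "(\<lambda>N. \<integral>u. g N (u / \<sigma> N) \<partial>lborel) \<longlonglongrightarrow> (\<integral>u. complex_of_real (exp (- u\<^sup>2 / 2)) \<partial>lborel)"
  proof (rule integral_dominated_convergence)
    show "(\<lambda>u. complex_of_real (exp (- u\<^sup>2 / 2))) \<in> borel_measurable lborel" by measurable
    show "(\<lambda>u. g N (u / \<sigma> N)) \<in> borel_measurable lborel" for N unfolding g_def by measurable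
    show "integrable lborel (\<lambda>u. exp (- c * u\<^sup>2))" by (rule integrable_exp_square[OF c])
    \<comment> \<open>The dominating function does not depend on N: inside the cut-off the Gaussian
      bound reads c v (u / \<sigma>)^2 = c u^2, and outside it the integrand is 0.\<close>
    show "AE u in lborel. norm (g N (u / \<sigma> N)) \<le> exp (- c * u\<^sup>2)" for N
    proof (intro AE_I2)
      fix u
      show "norm (g N (u / \<sigma> N)) \<le> exp (- c * u\<^sup>2)"
      proof (cases "\<bar>u / \<sigma> N\<bar> \<le> pi")
        case True
        have "norm (g N (u / \<sigma> N)) \<le> norm (cf (q N) (u / \<sigma> N))"
          by (auto simp: g_def norm_mult indicator_def)
        also have "\<dots> = exp (Re (\<psi> N (u / \<sigma> N)))" by (simp add: \<psi>(1))
        also have "\<dots> \<le> exp (- c * v N * (u / \<sigma> N)\<^sup>2)" using \<psi>(3)[OF True] by simp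
        also have "- c * v N * (u / \<sigma> N)\<^sup>2 = - c * u\<^sup>2"
          using v_pos[of N] by (simp add: power_divide \<sigma>)
        finally show ?thesis .
      qed (auto simp: g_def indicator_def abs_le_iff)
    qed
    show "AE u in lborel. (\<lambda>N. g N (u / \<sigma> N)) \<longlonglongrightarrow> complex_of_real (exp (- u\<^sup>2 / 2))"
    proof (intro AE_I2)
      fix u :: real
      \<comment> \<open>\<open>e N\<close> is the exponent of the rescaled integrand. It differs
        from - u^2 / 2 by the cubic remainder, of order 1 / \<sigma>, and by the centring error u (k
        - m) / \<sigma>.\<close>
      define e where "e N = \<psi> N (u / \<sigma> N) + \<i> * (- (u / \<sigma> N) * real (k N))" for N
      have "(\<lambda>N. e N - complex_of_real (- u\<^sup>2 / 2)) \<longlonglongrightarrow> 0"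
      proof (rule Lim_null_comparison)
        show "\<forall>\<^sub>F N in sequentially. norm (e N - complex_of_real (- u\<^sup>2 / 2))
           \<le> C * \<bar>u\<bar> ^ 3 * (1 / \<sigma> N) + \<bar>u\<bar> * \<bar>(real (k N) - m N) / \<sigma> N\<bar>"
        proof (intro always_eventually allI)
          fix N
          let ?t = "u / \<sigma> N"
          have "v N \<noteq> 0" using v_pos[of N] by simp
          then have t2: "?t\<^sup>2 * v N = u\<^sup>2" using \<sigma>(1)[of N] by (simp add: power_divide \<sigma>(2))
          have "e N - complex_of_real (- u\<^sup>2 / 2) =
             (\<psi> N ?t - (\<i> * complex_of_real (?t * m N) - complex_of_real (?t\<^sup>2 * v N / 2)))
              + \<i> * complex_of_real (- u * ((real (k N) - m N) / \<sigma> N))"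
            unfolding t2 using \<sigma>(1)[of N] by (simp add: e_def field_simps)
          also have "norm \<dots> \<le> C * v N * \<bar>?t\<bar> ^ 3 + \<bar>- u * ((real (k N) - m N) / \<sigma> N)\<bar>"
            by (intro norm_triangle_le add_mono \<psi>(2)) (simp only: norm_mult norm_of_real norm_ii)
          also have "C * v N * \<bar>?t\<bar> ^ 3 = C * \<bar>u\<bar> ^ 3 * (1 / \<sigma> N)"
            using \<sigma>(1)[of N] by (simp add: \<sigma>(2)[symmetric] power_divide power2_eq_square power3_eq_cube)
          finally show "norm (e N - complex_of_real (- u\<^sup>2 / 2))
           \<le> C * \<bar>u\<bar> ^ 3 * (1 / \<sigma> N) + \<bar>u\<bar> * \<bar>(real (k N) - m N) / \<sigma> N\<bar>"
            by (simp add: abs_mult)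
        qed
        have "(\<lambda>N. 1 / \<sigma> N) \<longlonglongrightarrow> 0"
          using tendsto_inverse_0_at_top[OF \<sigma>_inf] by (simp add: inverse_eq_divide)
        moreover have "(\<lambda>N. \<bar>(real (k N) - m N) / \<sigma> N\<bar>) \<longlonglongrightarrow> 0"
          using k unfolding \<sigma>_def by (rule tendsto_rabs_zero)
        ultimately show "(\<lambda>N. C * \<bar>u\<bar> ^ 3 * (1 / \<sigma> N) + \<bar>u\<bar> * \<bar>(real (k N) - m N) / \<sigma> N\<bar>) \<longlonglongrightarrow> 0"
          by (intro tendsto_add_zero tendsto_mult_right_zero)
      qed
      then have "(\<lambda>N. e N) \<longlonglongrightarrow> complex_of_real (- u\<^sup>2 / 2)" by (rule LIM_zero_cancel)
      then have lim: "(\<lambda>N. exp (e N)) \<longlonglongrightarrow> complex_of_real (exp (- u\<^sup>2 / 2))"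
        by (subst exp_of_real[symmetric]) (rule tendsto_exp)
      \<comment> \<open>For fixed u the cut-off at pi is eventually inactive.\<close>
      have "\<forall>\<^sub>F N in sequentially. \<bar>u\<bar> / pi \<le> \<sigma> N"
        using \<sigma>_inf by (simp add: filterlim_at_top)
      then have "\<forall>\<^sub>F N in sequentially. exp (e N) = g N (u / \<sigma> N)"
      proof eventually_elim
        case (elim N)
        then have "\<bar>u / \<sigma> N\<bar> \<le> pi" using \<sigma>(1)[of N] by (simp add: field_simps)
        then have "u / \<sigma> N \<in> {-pi..pi}" unfolding abs_le_iff atLeastAtMost_iff by linarith
        then have "indicator {-pi..pi} (u / \<sigma> N) = (1 :: real)" by (rule indicator_simps)
        then show ?case unfolding g_def e_def \<psi>(1) exp_add by (simp only: scaleR_one)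
      qed
      with lim show "(\<lambda>N. g N (u / \<sigma> N)) \<longlonglongrightarrow> complex_of_real (exp (- u\<^sup>2 / 2))"
        by (rule Lim_transform_eventually)
    qed
  qed
  also have "(\<integral>u. complex_of_real (exp (- u\<^sup>2 / 2)) \<partial>lborel) = complex_of_real (sqrt (2 * pi))"
    by (subst integral_complex_of_real) (simp only: integral_exp_half_square)
  finally have "(\<lambda>N. complex_of_real (2 * pi * (\<sigma> N * pmf (q N) (k N)))) \<longlonglongrightarrow> complex_of_real (sqrt (2 * pi))"
    by (simp only: inv)
  then have "(\<lambda>N. 2 * pi * (\<sigma> N * pmf (q N) (k N))) \<longlonglongrightarrow> sqrt (2 * pi)"
    by (simp only: tendsto_of_real_iff)
  then have "(\<lambda>N. 2 * pi * (\<sigma> N * pmf (q N) (k N)) / (2 * pi)) \<longlonglongrightarrow> sqrt (2 * pi) / (2 * pi)"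
    by (intro tendsto_intros) auto
  moreover have "sqrt (2 * pi) / (2 * pi) = 1 / sqrt (2 * pi)"
    by (simp add: sqrt_divide_self_eq inverse_eq_divide)
  ultimately show ?thesis by (simp add: \<sigma>_def)
qed

text \<open>The bounds on the loads come from a limsup and hold only for large N; an initial segment
  is shifted away.\<close>

lemma local_limit_theorem_eventually:
  fixes q :: "nat \<Rightarrow> nat pmf"
  assumes bd: "\<forall>\<^sub>F N in sequentially. cumulant_bounds C c (q N) (m N) (v N)" and c: "0 < c"
    and v: "filterlim v at_top sequentially"
    and k: "(\<lambda>N. (real (k N) - m N) / sqrt (v N)) \<longlonglongrightarrow> 0"
  shows "(\<lambda>N. sqrt (v N) * pmf (q N) (k N)) \<longlonglongrightarrow> 1 / sqrt (2 * pi)"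
proof -
  have "\<forall>\<^sub>F N in sequentially. 0 < v N" using v by (simp add: filterlim_at_top_dense)
  with bd have "\<forall>\<^sub>F N in sequentially. cumulant_bounds C c (q N) (m N) (v N) \<and> 0 < v N"
    by (rule eventually_conj)
  then obtain n where n: "\<And>N. n \<le> N \<Longrightarrow> cumulant_bounds C c (q N) (m N) (v N) \<and> 0 < v N"
    by (auto simp: eventually_sequentially)
  have "(\<lambda>N. sqrt (v (N + n)) * pmf (q (N + n)) (k (N + n))) \<longlonglongrightarrow> 1 / sqrt (2 * pi)"
  proof (rule local_limit_theorem[OF _ c])
    show "cumulant_bounds C c (q (N + n)) (m (N + n)) (v (N + n))" "0 < v (N + n)" for N
      using n[of "N + n"] by auto
    show "filterlim (\<lambda>N. v (N + n)) at_top sequentially"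
      by (rule filterlim_compose[OF v filterlim_add_const_nat_at_top])
    show "(\<lambda>N. (real (k (N + n)) - m (N + n)) / sqrt (v (N + n))) \<longlonglongrightarrow> 0"
      using LIMSEQ_ignore_initial_segment[OF k, of n] .
  qed
  then show ?thesis by (rule LIMSEQ_offset)
qed

section \<open>The stationary distribution of the occupation process\<close>

lemma finite_states: "finite (states N M)"
proof (rule finite_subset)
  show "states N M \<subseteq> PiE_dflt {1..N} 0 (\<lambda>_. {..M})"
  proof
    fix x assume x: "x \<in> states N M"
    have "x j \<le> M" if "j \<in> {1..N}" for j
      using member_le_sum[of j "{1..N}" x] x that by (simp add: states_def)
    with x show "x \<in> PiE_dflt {1..N} 0 (\<lambda>_. {..M})" by (auto simp: states_def PiE_dflt_def)
  qed
qed auto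

lemma move_apply: "move i j x k = (if k = i \<and> k = j then x k - 1 + 1 else if k = i then x k - 1 else if k = j then x k + 1 else x k)"
  by (simp add: move_def Let_def)

text \<open>With k = i and \<open>move_self\<close> this says that \<open>move j i\<close> undoes
  \<open>move i j\<close>.\<close>

lemma move_move: "1 \<le> x i \<Longrightarrow> move j k (move i j x) = move i k x"
  by (auto simp: fun_eq_iff move_apply)

lemma move_self: "1 \<le> x i \<Longrightarrow> move i i x = x"
  by (auto simp: fun_eq_iff move_apply)

lemma move_states:
  assumes x: "x \<in> states N M" and i: "i \<in> {1..N}" and j: "j \<in> {1..N}" and "1 \<le> x i"
  shows "move i j x \<in> states N M"
proof -
  let ?z = "x(i := x i - 1)"
  have "sum x {1..N} = x i + sum x ({1..N} - {i})" using i by (intro sum.remove) auto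
  moreover have "sum ?z {1..N} = ?z i + sum ?z ({1..N} - {i})" using i by (intro sum.remove) auto
  moreover have "sum ?z ({1..N} - {i}) = sum x ({1..N} - {i})" by (intro sum.cong) auto
  ultimately have 1: "sum x {1..N} = sum ?z {1..N} + 1" using assms(4) by simp
  let ?w = "?z(j := ?z j + 1)"
  have "sum ?z {1..N} = ?z j + sum ?z ({1..N} - {j})" using j by (intro sum.remove) auto
  moreover have "sum ?w {1..N} = ?w j + sum ?w ({1..N} - {j})" using j by (intro sum.remove) auto
  moreover have "sum ?w ({1..N} - {j}) = sum ?z ({1..N} - {j})" by (intro sum.cong) auto
  ultimately have 2: "sum ?w {1..N} = sum ?z {1..N} + 1" by simp
  have "move i j x = ?w" by (simp add: move_def Let_def)
  then show ?thesis using 1 2 x i j unfolding states_def by auto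
qed

text \<open>All states are connected through the state with all customers at one node.\<close>

lemma states_connected:
  assumes A: "\<And>x i j. x \<in> A \<Longrightarrow> i \<in> {1..N} \<Longrightarrow> j \<in> {1..N} \<Longrightarrow> 1 \<le> x i \<Longrightarrow> move i j x \<in> A"
    and sub: "A \<subseteq> states N M" and ne: "A \<noteq> {}" and N: "1 \<le> N"
  shows "A = states N M"
proof -
  define e where "e k = (if k = 1 then M else 0)" for k :: nat
  have one: "(1::nat) \<in> {1..N}" using N by simp
  \<comment> \<open>An equivalence is needed: one member of the non-empty \<open>A\<close> puts
    \<open>e\<close> into \<open>A\<close>, and \<open>e\<close> then puts every state there. The
    induction is on the number of customers missing at node 1.\<close>
  have *: "x \<in> A \<longleftrightarrow> e \<in> A" if "x \<in> states N M" for x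
    using that
  proof (induction "M - x 1" arbitrary: x rule: less_induct)
    case less
    have s: "sum x {1..N} = M" "\<And>j. j \<notin> {1..N} \<Longrightarrow> x j = 0" using less.prems by (auto simp: states_def)
    have s1: "sum x {1..N} = x 1 + sum x ({1..N} - {1})" using one by (intro sum.remove) auto
    show ?case
    proof (cases "x 1 = M")
      case True
      then have "sum x ({1..N} - {1}) = 0" using s s1 by simp
      then have "x k = e k" for k using s(2)[of k] True by (cases "k \<in> {1..N}") (auto simp: e_def)
      then have "x = e" by blast
      then show ?thesis by simp
    next
      case False
      then have "sum x ({1..N} - {1}) \<noteq> 0" using s s1 by simp
      then obtain j where "j \<in> {1..N} - {1}" "x j \<noteq> 0" by (rule sum.not_neutral_contains_not_neutral)
      then have j: "j \<in> {1..N}" "j \<noteq> 1" "x j \<noteq> 0" by auto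
      let ?x = "move j 1 x"
      have x1: "?x 1 = x 1 + 1" using j by (simp add: move_apply)
      have "x 1 < M" using False s(1) s1 by linarith
      then have "?x \<in> A \<longleftrightarrow> e \<in> A"
        using less.hyps[of ?x] move_states[OF less.prems j(1) one] j x1 by simp
      \<comment> \<open>Moving the customer back returns to \<open>x\<close>, so closure of
        \<open>A\<close> gives both directions.\<close>
      moreover have "move 1 j ?x = x" using j by (simp add: move_move move_self)
      then have "?x \<in> A \<longleftrightarrow> x \<in> A"
        using A[of ?x 1 j] A[of x j 1] j one x1 by auto
      ultimately show ?thesis by simp
    qed
  qed
  with ne sub show ?thesis by blast
qed

text \<open>The factors are left general: instantiated with the pmfs of the free variables, they
  give the product form up to a constant on \<open>states N M\<close>.\<close>

definition product_weight :: "nat \<Rightarrow> (nat \<Rightarrow> nat \<Rightarrow> real) \<Rightarrow> (nat \<Rightarrow> nat) \<Rightarrow> real" where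
  "product_weight N f x = (\<Prod>j\<in>{1..N}. f j (x j))"

context closed_jackson_network
begin

lemma N_pos: "1 \<le> N"
  using nodes by (cases N) auto

text \<open>Some entry is positive because the entries sum to 1, and invariance carries positivity
  along every edge with positive routing probability.\<close>

lemma traffic_pos:
  assumes j: "j \<in> {1..N}"
  shows "0 < \<theta> j"
proof -
  have inv: "\<And>j. j \<in> {1..N} \<Longrightarrow> 0 \<le> \<theta> j" "(\<Sum>j\<in>{1..N}. \<theta> j) = 1"
    "\<And>j. j \<in> {1..N} \<Longrightarrow> (\<Sum>i\<in>{1..N}. \<theta> i * P i j) = \<theta> j"
    using invariant by (auto simp: invariant_prob_vector_on_def)
  have P: "\<And>i j. i \<in> {1..N} \<Longrightarrow> j \<in> {1..N} \<Longrightarrow> 0 \<le> P i j"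
    using stochastic by (auto simp: stochastic_on_def)
  obtain i where i: "i \<in> {1..N}" "\<theta> i \<noteq> 0" using inv(2) by (metis sum.neutral zero_neq_one)
  have "(i, j) \<in> {(a, b). a \<in> {1..N} \<and> b \<in> {1..N} \<and> P a b > 0}\<^sup>*"
    using irreducible i j by (auto simp: irreducible_on_def)
  then show ?thesis
  proof (induction rule: rtrancl_induct)
    case base
    then show ?case using i inv(1)[of i] by simp
  next
    case (step k l)
    then have "0 < \<theta> k * P k l" by simp
    also have "\<dots> \<le> (\<Sum>k\<in>{1..N}. \<theta> k * P k l)"
      using step inv(1) P by (intro member_le_sum) (auto intro: mult_nonneg_nonneg)
    also have "\<dots> = \<theta> l" using step inv(3) by simp
    finally show ?case .
  qed
qed

lemma service_rate_zero: "service_rate J1 \<mu> i 0 = 0"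
  by (simp add: service_rate_def)

lemma service_rate_pos: "i \<in> {1..N} \<Longrightarrow> 1 \<le> k \<Longrightarrow> 0 < service_rate J1 \<mu> i k"
  using service_pos[of i] by (simp add: service_rate_def)

section \<open>Product-form weights: invariance and uniqueness of the stationary law\<close>

context
  fixes f :: "nat \<Rightarrow> nat \<Rightarrow> real" and c :: real and M :: nat
  assumes f_pos: "\<And>j k. j \<in> {1..N} \<Longrightarrow> 0 < f j k"
    and f_rec: "\<And>j k. j \<in> {1..N} \<Longrightarrow> f j (Suc k) * service_rate J1 \<mu> j (Suc k) = c * \<theta> j * f j k"
begin

abbreviation "weight \<equiv> product_weight N f"

lemma weight_pos: "0 < weight x"
  unfolding product_weight_def by (intro prod_pos f_pos)

text \<open>\<open>f_rec\<close> is detailed balance for a single node fed at rate c \<theta>_j; the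
  factors of the other nodes are untouched.\<close>

lemma weight_add:
  assumes j: "j \<in> {1..N}"
  shows "weight (z(j := Suc (z j))) * service_rate J1 \<mu> j (Suc (z j)) = c * \<theta> j * weight z"
proof -
  have *: "weight x = f j (x j) * (\<Prod>k\<in>{1..N} - {j}. f k (x k))" for x
    unfolding product_weight_def using j by (intro prod.remove) auto
  have "(\<Prod>k\<in>{1..N} - {j}. f k ((z(j := Suc (z j))) k)) = (\<Prod>k\<in>{1..N} - {j}. f k (z k))"
    by (intro prod.cong) auto
  then show ?thesis using f_rec[OF j, of "z j"] by (simp add: * algebra_simps)
qed

text \<open>Both states arise by adding one customer to the same configuration \<open>?z\<close>, so
  both sides equal c \<theta>_i \<theta>_j times the weight of \<open>?z\<close>.\<close>

lemma weight_move:
  assumes i: "i \<in> {1..N}" and j: "j \<in> {1..N}" and y: "1 \<le> y j"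
  shows "weight (move j i y) * service_rate J1 \<mu> i (move j i y i) * \<theta> j = weight y * service_rate J1 \<mu> j (y j) * \<theta> i"
proof -
  let ?z = "y(j := y j - 1)"
  have "y = ?z(j := Suc (?z j))" using y by auto
  then have "weight y * service_rate J1 \<mu> j (y j) = c * \<theta> j * weight ?z"
    using weight_add[OF j, of ?z] y by simp
  moreover have "move j i y = ?z(i := Suc (?z i))" by (simp add: move_def Let_def)
  then have "weight (move j i y) * service_rate J1 \<mu> i (move j i y i) = c * \<theta> i * weight ?z"
    using weight_add[OF i, of ?z] by simp
  ultimately show ?thesis by (simp add: algebra_simps)
qed

text \<open>Flow balances node by node: the inflow through arrivals at j is \<open>weight y\<close>
  times the service rate at j, by the traffic equations, and this is also the outflow through
  departures from j, since the rows of \<open>P\<close> sum to 1. The dummy moves are counted on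
  both sides.\<close>

lemma weight_balance:
  assumes y: "y \<in> states N M"
  shows "(\<Sum>x\<in>states N M. weight x * jump_rate N J1 P \<mu> x y) = weight y * (\<Sum>z\<in>states N M. jump_rate N J1 P \<mu> y z)"
proof -
  let ?S = "states N M" and ?V = "{1..N}" and ?g = "service_rate J1 \<mu>"
  have out: "(\<Sum>z\<in>?S. if move i j y = z then ?g i (y i) * P i j else 0) = ?g i (y i) * P i j"
    if "i \<in> ?V" "j \<in> ?V" for i j
    using move_states[OF y that] finite_states by (cases "y i = 0") (auto simp: service_rate_zero)
  have "(\<Sum>z\<in>?S. jump_rate N J1 P \<mu> y z) = (\<Sum>i\<in>?V. \<Sum>j\<in>?V. \<Sum>z\<in>?S. if move i j y = z then ?g i (y i) * P i j else 0)"
    unfolding jump_rate_def by (subst sum.swap, intro sum.cong refl, rule sum.swap)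
  also have "\<dots> = (\<Sum>i\<in>?V. \<Sum>j\<in>?V. ?g i (y i) * P i j)" by (intro sum.cong refl out)
  also have "\<dots> = (\<Sum>i\<in>?V. ?g i (y i))"
    using stochastic by (intro sum.cong refl) (simp add: sum_distrib_left[symmetric] stochastic_on_def)
  finally have R: "(\<Sum>z\<in>?S. jump_rate N J1 P \<mu> y z) = (\<Sum>i\<in>?V. ?g i (y i))" .
  \<comment> \<open>Among states with a customer at i, only \<open>move j i y\<close> can lead to
    \<open>y\<close> by a move from i to j, and none can if j is empty in \<open>y\<close>.\<close>
  have inn: "(\<Sum>x\<in>?S. weight x * (if move i j x = y then ?g i (x i) * P i j else 0))
       = weight y * ?g j (y j) / \<theta> j * (\<theta> i * P i j)"
    if ij: "i \<in> ?V" "j \<in> ?V" for i j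
  proof (cases "y j = 0")
    case True
    have "weight x * (if move i j x = y then ?g i (x i) * P i j else 0) = 0" for x
      using True by (cases "x i = 0") (auto simp: service_rate_zero move_apply split: if_splits)
    then have "(\<Sum>x\<in>?S. weight x * (if move i j x = y then ?g i (x i) * P i j else 0)) = 0"
      by (intro sum.neutral ballI)
    then show ?thesis using True by (simp add: service_rate_zero)
  next
    case False
    let ?x = "move j i y"
    have "weight x * (if move i j x = y then ?g i (x i) * P i j else 0) = 0" if "x \<noteq> ?x" for x
    proof (cases "x i = 0")
      case False
      then have "move j i (move i j x) = x" by (simp add: move_move move_self)
      then show ?thesis using that by auto
    qed (simp add: service_rate_zero)
    then have "(\<Sum>x\<in>?S. weight x * (if move i j x = y then ?g i (x i) * P i j else 0))
       = (\<Sum>x\<in>{?x}. weight x * (if move i j x = y then ?g i (x i) * P i j else 0))"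
      using move_states[OF y ij(2) ij(1)] False finite_states by (intro sum.mono_neutral_right) auto
    also have "\<dots> = weight ?x * ?g i (?x i) * P i j"
      using False by (simp add: move_move move_self)
    also have "weight ?x * ?g i (?x i) = weight y * ?g j (y j) / \<theta> j * \<theta> i"
      using weight_move[OF ij] False traffic_pos[OF ij(2)] by (simp add: field_simps)
    finally show ?thesis by simp
  qed
  have "(\<Sum>x\<in>?S. weight x * jump_rate N J1 P \<mu> x y)
      = (\<Sum>i\<in>?V. \<Sum>j\<in>?V. \<Sum>x\<in>?S. weight x * (if move i j x = y then ?g i (x i) * P i j else 0))"
    unfolding jump_rate_def sum_distrib_left by (subst sum.swap, intro sum.cong refl, rule sum.swap)
  also have "\<dots> = (\<Sum>i\<in>?V. \<Sum>j\<in>?V. weight y * ?g j (y j) / \<theta> j * (\<theta> i * P i j))" by (intro sum.cong refl inn)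
  also have "\<dots> = (\<Sum>j\<in>?V. weight y * ?g j (y j) / \<theta> j * (\<Sum>i\<in>?V. \<theta> i * P i j))"
    by (subst sum.swap) (simp only: sum_distrib_left)
  also have "\<dots> = (\<Sum>j\<in>?V. weight y * ?g j (y j))"
  proof (intro sum.cong refl)
    fix j assume j: "j \<in> ?V"
    then have "(\<Sum>i\<in>?V. \<theta> i * P i j) = \<theta> j" using invariant by (simp add: invariant_prob_vector_on_def)
    then show "weight y * ?g j (y j) / \<theta> j * (\<Sum>i\<in>?V. \<theta> i * P i j) = weight y * ?g j (y j)"
      using traffic_pos[OF j] by simp
  qed
  finally show ?thesis by (simp add: R sum_distrib_left)
qed

text \<open>Maximum principle for the density \<open>h\<close> of the stationary law relative to the
  weights: where \<open>h\<close> is maximal, balance forces the same value at every predecessor,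
  and irreducibility spreads it to all states.\<close>

lemma stationary_distribution_unique:
  assumes st: "stationary_distribution N J1 P \<mu> M p" and x: "x \<in> states N M"
  shows "pmf p x = weight x / (\<Sum>x\<in>states N M. weight x)"
proof -
  let ?S = "states N M" and ?R = "jump_rate N J1 P \<mu>"
  define h where "h x = pmf p x / weight x" for x
  have p: "pmf p x = h x * weight x" for x using weight_pos[of x] by (simp add: h_def)
  have fin: "finite ?S" by (rule finite_states)
  have P: "\<And>i j. i \<in> {1..N} \<Longrightarrow> j \<in> {1..N} \<Longrightarrow> 0 \<le> P i j"
    using stochastic by (auto simp: stochastic_on_def)
  have g: "0 \<le> service_rate J1 \<mu> i k" if "i \<in> {1..N}" for i k
    using service_rate_pos[OF that, of k] by (cases "k = 0") (auto simp: service_rate_zero)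
  have R_nonneg: "0 \<le> ?R x y" for x y
    unfolding jump_rate_def by (intro sum_nonneg) (auto intro!: mult_nonneg_nonneg P g)
  have bal: "(\<Sum>x\<in>?S - {y}. weight x * ?R x y * (h y - h x)) = 0" if y: "y \<in> ?S" for y
  proof -
    have "0 = (\<Sum>x\<in>?S. pmf p x * generator N J1 P \<mu> M x y)"
      using st y by (simp add: stationary_distribution_def)
    also have "\<dots> = pmf p y * generator N J1 P \<mu> M y y + (\<Sum>x\<in>?S - {y}. pmf p x * generator N J1 P \<mu> M x y)"
      using fin y by (rule sum.remove)
    also have "(\<Sum>x\<in>?S - {y}. pmf p x * generator N J1 P \<mu> M x y) = (\<Sum>x\<in>?S - {y}. pmf p x * ?R x y)"
      by (intro sum.cong) (auto simp: generator_def)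
    finally have 1: "(\<Sum>x\<in>?S - {y}. pmf p x * ?R x y) = h y * (weight y * (\<Sum>z\<in>?S - {y}. ?R y z))"
      by (simp add: generator_def p algebra_simps)
    \<comment> \<open>Removing the term of the dummy moves from both sides brings
      \<open>weight_balance\<close> into the form of the generator.\<close>
    have "(\<Sum>x\<in>?S. weight x * ?R x y) = weight y * ?R y y + (\<Sum>x\<in>?S - {y}. weight x * ?R x y)"
      "(\<Sum>z\<in>?S. ?R y z) = ?R y y + (\<Sum>z\<in>?S - {y}. ?R y z)"
      using fin y by (rule sum.remove)+
    with weight_balance[OF y] have 2: "(\<Sum>x\<in>?S - {y}. weight x * ?R x y) = weight y * (\<Sum>z\<in>?S - {y}. ?R y z)"
      by (simp add: algebra_simps)
    have "(\<Sum>x\<in>?S - {y}. weight x * ?R x y * (h y - h x))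
       = h y * (\<Sum>x\<in>?S - {y}. weight x * ?R x y) - (\<Sum>x\<in>?S - {y}. pmf p x * ?R x y)"
      by (simp add: sum_subtractf[symmetric] sum_distrib_left p algebra_simps)
    then show ?thesis by (simp add: 1 2)
  qed
  define m where "m = Max (h ` ?S)"
  define A where "A = {x \<in> ?S. h x = m}"
  have ne: "?S \<noteq> {}" using x by auto
  have m: "h x \<le> m" if "x \<in> ?S" for x using that fin by (simp add: m_def)
  \<comment> \<open>A routing edge from i to j makes \<open>move j i y\<close> a predecessor of
    \<open>y\<close>; maximality therefore travels against the jumps.\<close>
  have edge: "move j i y \<in> A" if y: "y \<in> A" "1 \<le> y j" and ij: "i \<in> {1..N}" "j \<in> {1..N}" "0 < P i j" for i j y
  proof (cases "move j i y = y")
    case False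
    let ?x = "move j i y"
    have yS: "y \<in> ?S" "h y = m" using y by (auto simp: A_def)
    have xS: "?x \<in> ?S" using move_states[OF yS(1) ij(2,1) y(2)] .
    have "\<forall>x\<in>?S - {y}. weight x * ?R x y * (h y - h x) = 0"
      using bal[OF yS(1)] fin m yS(2) weight_pos R_nonneg
      by (subst (asm) sum_nonneg_eq_0_iff) (auto intro!: mult_nonneg_nonneg simp: less_imp_le)
    with xS False have 0: "weight ?x * ?R ?x y * (h y - h ?x) = 0" by blast
    have "0 < service_rate J1 \<mu> i (?x i) * P i j"
      using ij y(2) by (intro mult_pos_pos service_rate_pos) (auto simp: move_apply)
    also have "\<dots> = (if move i j ?x = y then service_rate J1 \<mu> i (?x i) * P i j else 0)"
      using y(2) by (simp add: move_move move_self)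
    also have "\<dots> \<le> (\<Sum>j\<in>{1..N}. if move i j ?x = y then service_rate J1 \<mu> i (?x i) * P i j else 0)"
      using ij P g by (intro member_le_sum) auto
    also have "\<dots> \<le> ?R ?x y"
      unfolding jump_rate_def using ij P g
      by (intro member_le_sum[of i "{1..N}" "\<lambda>i. \<Sum>j\<in>{1..N}. if move i j ?x = y then service_rate J1 \<mu> i (?x i) * P i j else 0"])
         (auto intro!: sum_nonneg)
    finally have "h ?x = h y" using 0 weight_pos[of ?x] by auto
    with xS yS show ?thesis by (simp add: A_def)
  qed (use y in simp)
  \<comment> \<open>Composing edges along a routing path from i to j gives closure under arbitrary
    moves, as \<open>states_connected\<close> requires.\<close>
  have path: "move j i y \<in> A" if y: "y \<in> A" "1 \<le> y j" and i: "i \<in> {1..N}" and j: "j \<in> {1..N}" for i j y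
  proof -
    have "(i, j) \<in> {(a, b). a \<in> {1..N} \<and> b \<in> {1..N} \<and> P a b > 0}\<^sup>*"
      using irreducible i j by (auto simp: irreducible_on_def)
    then show ?thesis
    proof (induction rule: converse_rtrancl_induct)
      case base
      then show ?case using y by (simp add: move_self)
    next
      case (step i k)
      have "1 \<le> move j k y k" using y(2) by (auto simp: move_apply)
      then have "move k i (move j k y) \<in> A" using step by (intro edge[where y = "move j k y" and j = k and i = i]) auto
      then show ?case using y(2) by (simp add: move_move)
    qed
  qed
  have "m \<in> h ` ?S" unfolding m_def using fin ne by (intro Max_in) auto
  then have "A \<noteq> {}" by (auto simp: A_def)
  then have "A = ?S"
    using path N_pos by (intro states_connected) (auto simp: A_def)
  then have pm: "pmf p x = m * weight x" if "x \<in> ?S" for x using that by (auto simp: A_def p)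
  have "1 = (\<Sum>x\<in>?S. pmf p x)"
    using st fin by (intro sum_pmf_eq_1[symmetric]) (auto simp: stationary_distribution_def)
  also have "\<dots> = m * (\<Sum>x\<in>?S. weight x)" by (simp add: pm sum_distrib_left)
  finally show ?thesis using pm[OF x] by (metis divide_inverse inverse_unique mult.commute)
qed

end

end

section \<open>Conditioning the free variables on the number of customers\<close>

text \<open>The product law is carried by vectors that vanish outside the nodes, so only the
  constraint on the total matters.\<close>

lemma measure_Pi_pmf_states:
  "measure_pmf.prob (Pi_pmf {1..N} 0 F) (states N M \<inter> E)
     = measure_pmf.prob (Pi_pmf {1..N} 0 F) ({x. sum x {1..N} = M} \<inter> E)"
proof (rule measure_prob_cong_0)
  fix x assume "x \<in> {x. sum x {1..N} = M} \<inter> E - states N M \<inter> E"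
  then show "pmf (Pi_pmf {1..N} 0 F) x = 0" by (intro pmf_Pi_outside) (auto simp: states_def)
qed (auto simp: states_def)

text \<open>The normalizing constant of the product form is thus the probability that the free
  variables sum to M.\<close>

lemma pmf_sum_law_states:
  "pmf (sum_law {1..N} F) M = (\<Sum>x\<in>states N M. product_weight N (\<lambda>j. pmf (F j)) x)"
proof -
  have "pmf (sum_law {1..N} F) M = measure_pmf.prob (Pi_pmf {1..N} 0 F) ({x. sum x {1..N} = M} \<inter> UNIV)"
    by (simp add: sum_law_def pmf_map vimage_def)
  also have "\<dots> = measure_pmf.prob (Pi_pmf {1..N} 0 F) (states N M)"
    using measure_Pi_pmf_states[of N F M UNIV] by simp
  also have "\<dots> = (\<Sum>x\<in>states N M. pmf (Pi_pmf {1..N} 0 F) x)"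
    by (rule measure_measure_pmf_finite[OF finite_states])
  also have "\<dots> = (\<Sum>x\<in>states N M. product_weight N (\<lambda>j. pmf (F j)) x)"
    by (intro sum.cong refl, subst pmf_Pi') (auto simp: states_def product_weight_def)
  finally show ?thesis .
qed

lemma sum_weight_cylinder:
  fixes n :: "nat \<Rightarrow> nat"
  assumes K: "K \<le> N" and s: "(\<Sum>j\<in>{1..K}. n j) \<le> M"
  shows "(\<Sum>x\<in>states N M \<inter> {x. \<forall>j\<in>{1..K}. x j = n j}. product_weight N (\<lambda>j. pmf (F j)) x)
    = (\<Prod>j\<in>{1..K}. pmf (F j) (n j)) * pmf (sum_law {K+1..N} F) (M - (\<Sum>j\<in>{1..K}. n j))"
proof -
  let ?A = "{1..K}" and ?B = "{K+1..N}"
  let ?E = "{x. \<forall>j\<in>?A. x j = n j}"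
  let ?G = "{g. sum g ?B = M - sum n ?A}"
  let ?h = "\<lambda>(f, g) x. if x \<in> ?A then f x else g x"
  let ?P = "pair_pmf (Pi_pmf ?A 0 F) (Pi_pmf ?B 0 F)"
  have V: "{1..N} = ?A \<union> ?B" and disj: "?A \<inter> ?B = {}" using K by auto
  have Q: "Pi_pmf {1..N} 0 F = map_pmf ?h ?P"
    unfolding V using disj by (intro Pi_pmf_union) auto
  have "(\<Sum>x\<in>states N M \<inter> ?E. product_weight N (\<lambda>j. pmf (F j)) x) = (\<Sum>x\<in>states N M \<inter> ?E. pmf (Pi_pmf {1..N} 0 F) x)"
    by (intro sum.cong refl, subst pmf_Pi') (auto simp: states_def product_weight_def)
  also have "\<dots> = measure_pmf.prob (Pi_pmf {1..N} 0 F) (states N M \<inter> ?E)"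
    by (intro measure_measure_pmf_finite[symmetric] finite_Int disjI1 finite_states)
  also have "\<dots> = measure_pmf.prob (Pi_pmf {1..N} 0 F) ({x. sum x {1..N} = M} \<inter> ?E)"
    by (rule measure_Pi_pmf_states)
  also have "\<dots> = measure_pmf.prob ?P (?h -` ({x. sum x {1..N} = M} \<inter> ?E))"
    unfolding Q by (rule measure_map_pmf)
  \<comment> \<open>Here \<open>s\<close> is used: the total prescribed for the remaining nodes must
    be an untruncated difference.\<close>
  also have "?h -` ({x. sum x {1..N} = M} \<inter> ?E) = ?E \<times> ?G"
  proof -
    have "sum (?h (f, g)) {1..N} = sum f ?A + sum g ?B" for f g :: "nat \<Rightarrow> nat"
    proof -
      have "sum (?h (f, g)) {1..N} = sum (?h (f, g)) ?A + sum (?h (f, g)) ?B"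
        unfolding V using disj by (intro sum.union_disjoint) auto
      also have "sum (?h (f, g)) ?A = sum f ?A" by (intro sum.cong) auto
      also have "sum (?h (f, g)) ?B = sum g ?B" by (intro sum.cong) auto
      finally show ?thesis .
    qed
    moreover have "sum f ?A = sum n ?A" if "\<forall>j\<in>?A. f j = n j" for f using that by (intro sum.cong) auto
    ultimately show ?thesis using s by (auto simp: vimage_def)
  qed
  also have "measure_pmf.prob ?P (?E \<times> ?G) = measure_pmf.prob (Pi_pmf ?A 0 F) ?E * measure_pmf.prob (Pi_pmf ?B 0 F) ?G"
  proof -
    \<comment> \<open>The product rule is applied to countable events, hence the restriction to the
      supports, which changes no probability.\<close>
    have "countable (set_pmf (Pi_pmf ?A 0 F))" "countable (set_pmf (Pi_pmf ?B 0 F))" by auto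
    then have "measure_pmf.prob ?P ((?E \<inter> set_pmf (Pi_pmf ?A 0 F)) \<times> (?G \<inter> set_pmf (Pi_pmf ?B 0 F)))
      = measure_pmf.prob (Pi_pmf ?A 0 F) (?E \<inter> set_pmf (Pi_pmf ?A 0 F)) * measure_pmf.prob (Pi_pmf ?B 0 F) (?G \<inter> set_pmf (Pi_pmf ?B 0 F))"
      by (intro measure_pmf_prob_product) auto
    moreover have "(?E \<inter> set_pmf (Pi_pmf ?A 0 F)) \<times> (?G \<inter> set_pmf (Pi_pmf ?B 0 F)) = (?E \<times> ?G) \<inter> set_pmf ?P"
      by auto
    ultimately show ?thesis by (simp only: measure_Int_set_pmf)
  qed
  also have "measure_pmf.prob (Pi_pmf ?A 0 F) ?E = (\<Prod>j\<in>?A. pmf (F j) (n j))"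
  proof -
    have "?E = Pi ?A (\<lambda>j. {n j})" by auto
    then show ?thesis by (simp add: measure_Pi_pmf_Pi measure_pmf_single)
  qed
  also have "measure_pmf.prob (Pi_pmf ?B 0 F) ?G = pmf (sum_law ?B F) (M - sum n ?A)"
    by (simp add: sum_law_def pmf_map vimage_def)
  finally show ?thesis .
qed

section \<open>Means, variances and loads of the free variables\<close>

definition free_mean :: "nat set \<Rightarrow> (nat \<Rightarrow> real) \<Rightarrow> real \<Rightarrow> nat \<Rightarrow> real" where
  "free_mean J1 r \<gamma> j = (if j \<in> J1 then \<gamma> * r j / (1 - \<gamma> * r j) else \<gamma> * r j)"

definition free_var :: "nat set \<Rightarrow> (nat \<Rightarrow> real) \<Rightarrow> real \<Rightarrow> nat \<Rightarrow> real" where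
  "free_var J1 r \<gamma> j = (if j \<in> J1 then \<gamma> * r j / (1 - \<gamma> * r j)\<^sup>2 else \<gamma> * r j)"

context closed_jackson_network
begin

lemma utilization_pos: "j \<in> {1..N} \<Longrightarrow> 0 < utilization \<theta> \<mu> j"
  by (simp add: utilization_def traffic_pos service_pos)

lemma J1_subset: "J1 \<subseteq> {1..N}" and finite_J: "finite J1" "finite J2"
  using nodes finite_subset[of J1 "{1..N}"] finite_subset[of J2 "{1..N}"] by auto

context
  fixes r :: "nat \<Rightarrow> real" and \<gamma> :: real and M :: nat
  assumes r: "r = utilization \<theta> \<mu>" and \<gamma>: "chemical_potential J1 J2 r M \<gamma>"
begin

lemma chemical_potential_nonneg: "0 \<le> \<gamma>"
  using \<gamma> by (simp add: chemical_potential_def)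

lemma load_le_Max:
  assumes "j \<in> J1"
  shows "\<gamma> * r j \<le> \<gamma> * Max (r ` J1)"
  using assms finite_J chemical_potential_nonneg by (intro mult_left_mono Max_ge) auto

lemma load_less_1:
  assumes j: "j \<in> J1"
  shows "\<gamma> * r j < 1"
proof -
  have "0 < r j" using j J1_subset r utilization_pos by auto
  also have "r j \<le> Max (r ` J1)" using j finite_J by (intro Max_ge) auto
  finally have "\<gamma> * Max (r ` J1) < 1"
    using \<gamma> by (simp add: chemical_potential_def pos_less_divide_eq)
  with load_le_Max[OF j] show ?thesis by simp
qed

lemma load_nonneg: "j \<in> {1..N} \<Longrightarrow> 0 \<le> \<gamma> * r j"
  using utilization_pos[of j] r chemical_potential_nonneg by simp

text \<open>This is the purpose of the chemical potential: M becomes the mean of the free sum, the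
  point where the local limit theorem has no centring error.\<close>

lemma sum_free_mean: "(\<Sum>j\<in>{1..N}. free_mean J1 r \<gamma> j) = real M"
proof -
  have "(\<Sum>j\<in>{1..N}. free_mean J1 r \<gamma> j) = (\<Sum>j\<in>J1. free_mean J1 r \<gamma> j) + (\<Sum>j\<in>J2. free_mean J1 r \<gamma> j)"
    unfolding nodes(1)[symmetric] using nodes(2) finite_J by (intro sum.union_disjoint)
  also have "(\<Sum>j\<in>J1. free_mean J1 r \<gamma> j) = (\<Sum>j\<in>J1. \<gamma> * r j / (1 - \<gamma> * r j))"
    by (simp add: free_mean_def)
  also have "(\<Sum>j\<in>J2. free_mean J1 r \<gamma> j) = (\<Sum>j\<in>J2. \<gamma> * r j)"
    using nodes(2) by (intro sum.cong) (auto simp: free_mean_def)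
  finally show ?thesis using \<gamma> by (simp add: chemical_potential_def)
qed

lemma has_moments_free_law:
  assumes j: "j \<in> {1..N}"
  shows "has_moments (free_law J1 r \<gamma> j) (free_mean J1 r \<gamma> j) (free_var J1 r \<gamma> j)"
proof (cases "j \<in> J1")
  case True
  then show ?thesis
    using has_moments_geometric[OF load_nonneg[OF j] load_less_1]
    by (simp add: free_law_def free_mean_def free_var_def)
next
  case False
  have "has_moments (return_pmf 0) 0 0" by (simp add: has_moments_def integrable_measure_pmf_finite)
  with False show ?thesis
    using has_moments_poisson[of "\<gamma> * r j"] load_nonneg[OF j]
    by (cases "\<gamma> * r j = 0") (simp_all only: free_law_def free_mean_def free_var_def if_True if_False, simp)
qed

lemma free_std_dev_eq: "free_std_dev N J1 r \<gamma> = sqrt (\<Sum>j\<in>{1..N}. free_var J1 r \<gamma> j)"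
  unfolding free_std_dev_def free_joint_law_def
  by (subst variance_sum_Pi_pmf[OF _ has_moments_free_law]) auto

lemma free_var_nonneg: "j \<in> {1..N} \<Longrightarrow> 0 \<le> free_var J1 r \<gamma> j"
  using load_nonneg[of j] by (simp add: free_var_def)

lemma free_mean_nonneg: "j \<in> {1..N} \<Longrightarrow> 0 \<le> free_mean J1 r \<gamma> j"
  using load_nonneg[of j] load_less_1[of j] by (auto simp: free_mean_def intro!: divide_nonneg_pos)

text \<open>Lets the variance of the first K nodes bound the shift of the mean as well.\<close>

lemma free_mean_le_var:
  assumes j: "j \<in> {1..N}"
  shows "free_mean J1 r \<gamma> j \<le> free_var J1 r \<gamma> j"
proof (cases "j \<in> J1")
  case True
  let ?p = "\<gamma> * r j"
  have p: "0 \<le> ?p" "?p < 1" using load_nonneg[OF j] load_less_1[OF True] by auto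
  then have "(1 - ?p) * (1 - ?p) \<le> (1 - ?p) * 1" by (intro mult_left_mono) auto
  then have "?p / (1 - ?p) \<le> ?p / (1 - ?p)\<^sup>2"
    using p by (intro divide_left_mono) (auto simp: power2_eq_square)
  then show ?thesis using True by (simp add: free_mean_def free_var_def)
qed (simp add: free_mean_def free_var_def)

context
  fixes \<rho> :: real
  assumes \<rho>: "\<gamma> * Max (r ` J1) \<le> \<rho>" "0 \<le> \<rho>" "\<rho> < 1"
begin

lemma load_le: "j \<in> J1 \<Longrightarrow> \<gamma> * r j \<le> \<rho>"
  using load_le_Max \<rho>(1) by fastforce

text \<open>The converse comparison, uniform under the load bound; it turns growth of the variance
  into growth of M.\<close>

lemma free_var_le:
  assumes j: "j \<in> {1..N}"
  shows "free_var J1 r \<gamma> j \<le> free_mean J1 r \<gamma> j / (1 - \<rho>)"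
proof (cases "j \<in> J1")
  case True
  let ?p = "\<gamma> * r j"
  have p: "0 \<le> ?p" "?p \<le> \<rho>" using load_nonneg[OF j] load_le[OF True] by auto
  have "?p / (1 - ?p)\<^sup>2 = ?p / (1 - ?p) / (1 - ?p)" by (simp add: power2_eq_square)
  also have "\<dots> \<le> ?p / (1 - ?p) / (1 - \<rho>)" using p \<rho> by (intro divide_left_mono) auto
  finally show ?thesis using True by (simp add: free_mean_def free_var_def)
next
  case False
  have "\<gamma> * r j * (1 - \<rho>) \<le> \<gamma> * r j" using load_nonneg[OF j] \<rho> by (intro mult_left_le) auto
  with False \<rho> show ?thesis by (simp add: free_mean_def free_var_def pos_le_divide_eq)
qed

text \<open>Single-server nodes among the first K thus contribute O(1) to the variance, which is
  o(b_N).\<close>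

lemma free_var_le_const:
  assumes j: "j \<in> J1"
  shows "free_var J1 r \<gamma> j \<le> 1 / (1 - \<rho>)\<^sup>2"
  unfolding free_var_def using j load_le[OF j] load_nonneg[of j] J1_subset \<rho>
  by (auto intro!: frac_le power_mono)

lemma cumulant_bounds_free_law:
  assumes j: "j \<in> {1..N}" and "0 < \<gamma>"
  shows "cumulant_bounds (1 / (3 * (1 - \<rho>))) ((1 - \<rho>)\<^sup>2 / 12) (free_law J1 r \<gamma> j) (free_mean J1 r \<gamma> j) (free_var J1 r \<gamma> j)"
proof (cases "j \<in> J1")
  case True
  then show ?thesis
    using cumulant_bounds_geometric[OF load_nonneg[OF j] load_le \<rho>(3)]
    by (simp add: free_law_def free_mean_def free_var_def)
next
  case False
  have "0 < \<gamma> * r j" "\<gamma> * r j \<noteq> 0" using utilization_pos[OF j] r assms(2) by auto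
  with False show ?thesis
    using cumulant_bounds_poisson[of "\<gamma> * r j" \<rho>] \<rho>
    by (simp add: free_law_def free_mean_def free_var_def del: mult_eq_0_iff)
qed

end

lemma prob_stationary_cylinder:
  fixes n :: "nat \<Rightarrow> nat"
  assumes st: "stationary_distribution N J1 P \<mu> M p" and \<gamma>_pos: "0 < \<gamma>"
    and K: "K \<le> N" and s: "(\<Sum>j\<in>{1..K}. n j) \<le> M"
  defines "F \<equiv> free_law J1 r \<gamma>"
  shows "measure_pmf.prob p {x. \<forall>j\<in>{1..K}. x j = n j} /
      (\<Prod>j\<in>{1..K}. measure_pmf.prob (free_joint_law N J1 r \<gamma>) {x. x j = n j})
    = pmf (sum_law {K+1..N} F) (M - (\<Sum>j\<in>{1..K}. n j)) / pmf (sum_law {1..N} F) M"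
proof -
  let ?w = "product_weight N (\<lambda>j. pmf (F j))" and ?E = "{x. \<forall>j\<in>{1..K}. x j = n j}"
  have l: "0 < \<gamma> * r j" if "j \<in> {1..N}" for j using utilization_pos[OF that] r \<gamma>_pos by simp
  have pos: "0 < pmf (F j) k" if j: "j \<in> {1..N}" for j k
    using l[OF j] load_less_1[of j] by (auto simp: F_def free_law_def)
  \<comment> \<open>Both kinds of node satisfy the recurrence with c = \<gamma>. Tilting by \<gamma>
    multiplies all weights on \<open>states N M\<close> by the same power \<gamma>^M, so it does not
    alter the normalized law.\<close>
  have "pmf (F j) (Suc k) * service_rate J1 \<mu> j (Suc k) = \<gamma> * \<theta> j * pmf (F j) k" if j: "j \<in> {1..N}" for j k
  proof -
    have "r j * \<mu> j = \<theta> j" using service_pos[OF j] by (simp add: r utilization_def)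
    moreover have "pmf (F j) (Suc k) * service_rate J1 \<mu> j (Suc k) = \<gamma> * (r j * \<mu> j) * pmf (F j) k"
    proof (cases "j \<in> J1")
      case True
      then show ?thesis using l[OF j] load_less_1[OF True] by (simp add: F_def free_law_def service_rate_def)
    next
      case False
      then show ?thesis using l[OF j] by (simp add: F_def free_law_def service_rate_def divide_simps)
    qed
    ultimately show ?thesis by simp
  qed
  note uniq = stationary_distribution_unique[where f = "\<lambda>j. pmf (F j)", OF pos this st]
  have "measure_pmf.prob p ?E = measure_pmf.prob p (states N M \<inter> ?E)"
    using st by (intro measure_prob_cong_0) (auto simp: stationary_distribution_def set_pmf_iff)
  also have "\<dots> = (\<Sum>x\<in>states N M \<inter> ?E. pmf p x)"
    by (intro measure_measure_pmf_finite finite_Int disjI1 finite_states)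
  also have "\<dots> = (\<Sum>x\<in>states N M \<inter> ?E. ?w x / (\<Sum>x\<in>states N M. ?w x))"
    by (intro sum.cong refl uniq) auto
  also have "\<dots> = (\<Sum>x\<in>states N M \<inter> ?E. ?w x) / pmf (sum_law {1..N} F) M"
    by (simp only: sum_divide_distrib pmf_sum_law_states)
  also have "(\<Sum>x\<in>states N M \<inter> ?E. ?w x) = (\<Prod>j\<in>{1..K}. pmf (F j) (n j)) * pmf (sum_law {K+1..N} F) (M - (\<Sum>j\<in>{1..K}. n j))"
    by (rule sum_weight_cylinder[OF K s])
  finally have "measure_pmf.prob p ?E = (\<Prod>j\<in>{1..K}. pmf (F j) (n j)) * pmf (sum_law {K+1..N} F) (M - (\<Sum>j\<in>{1..K}. n j)) / pmf (sum_law {1..N} F) M" .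
  moreover have "measure_pmf.prob (free_joint_law N J1 r \<gamma>) {x. x j = n j} = pmf (F j) (n j)" if "j \<in> {1..K}" for j
  proof -
    have "pmf (map_pmf (\<lambda>x. x j) (Pi_pmf {1..N} 0 F)) (n j) = pmf (F j) (n j)"
      using that K by (subst Pi_pmf_component) auto
    then show ?thesis by (simp add: pmf_map vimage_def free_joint_law_def F_def)
  qed
  moreover have "(\<Prod>j\<in>{1..K}. pmf (F j) (n j)) \<noteq> 0"
    using pos K by (force simp: prod_zero_iff less_le)
  ultimately show ?thesis by simp
qed

end

end

section \<open>The limit of the quotient of probabilities\<close>

theorem theorem4p1:
  fixes J1 J2 :: "nat \<Rightarrow> nat set"
    and P :: "nat \<Rightarrow> nat \<Rightarrow> nat \<Rightarrow> real"
    and \<theta> \<mu> r :: "nat \<Rightarrow> nat \<Rightarrow> real"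
    and M :: "nat \<Rightarrow> nat"
    and \<gamma> b :: "nat \<Rightarrow> real"
    and \<xi> \<eta> :: "nat \<Rightarrow> (nat \<Rightarrow> nat) pmf"
    and K :: nat
    and n :: "nat \<Rightarrow> nat"
  assumes network: "\<And>N. N \<ge> 1 \<Longrightarrow> closed_jackson_network N (J1 N) (J2 N) (P N) (\<theta> N) (\<mu> N)"
    and r: "\<And>N. r N = utilization (\<theta> N) (\<mu> N)"
    and \<xi>: "\<And>N. N \<ge> 1 \<Longrightarrow> stationary_distribution N (J1 N) (P N) (\<mu> N) (M N) (\<xi> N)"
    and \<gamma>: "\<And>N. N \<ge> 1 \<Longrightarrow> chemical_potential (J1 N) (J2 N) (r N) (M N) (\<gamma> N)"
    and \<eta>: "\<And>N. \<eta> N = free_joint_law N (J1 N) (r N) (\<gamma> N)"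
    and b: "\<And>N. b N = free_std_dev N (J1 N) (r N) (\<gamma> N)"
    and subcritical: "limsup (\<lambda>N. ereal (\<gamma> N * Max (r N ` J1 N))) < 1"
    and b_infinity: "filterlim b at_top sequentially"
    and K: "K \<ge> 1"
    and J2_negligible:
      "(\<lambda>N. (1 / b N) * (\<Sum>j\<in>J2 N \<inter> {1..K}. \<gamma> N * r N j)) \<longlonglongrightarrow> 0"
  shows "(\<lambda>N. measure_pmf.prob (\<xi> N) {x. \<forall>j\<in>{1..K}. x j = n j} /
              (\<Prod>j\<in>{1..K}. measure_pmf.prob (\<eta> N) {x. x j = n j})) \<longlonglongrightarrow> 1"
proof -
  define F where "F N = free_law (J1 N) (r N) (\<gamma> N)" for N
  define mean where "mean N = free_mean (J1 N) (r N) (\<gamma> N)" for N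
  define var where "var N = free_var (J1 N) (r N) (\<gamma> N)" for N
  define s where "s = (\<Sum>j\<in>{1..K}. n j)"
  define D where "D N = (\<Sum>j\<in>{1..K}. var N j)" for N
  define m where "m N = (\<Sum>j\<in>{K+1..N}. mean N j)" for N
  define v where "v N = (\<Sum>j\<in>{K+1..N}. var N j)" for N
  \<comment> \<open>Here \<sigma> is the variance b_N^2, in contrast to the standard deviation in
    \<open>local_limit_theorem\<close>.\<close>
  define \<sigma> where "\<sigma> N = (b N)\<^sup>2" for N

  obtain \<rho> where \<rho>: "limsup (\<lambda>N. ereal (\<gamma> N * Max (r N ` J1 N))) < ereal \<rho>" "ereal \<rho> < 1"
    using ereal_dense2[OF subcritical] by auto
  have ev_\<rho>: "\<forall>\<^sub>F N in sequentially. \<gamma> N * Max (r N ` J1 N) < \<rho>"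
    using Limsup_lessD[OF \<rho>(1)] by simp
  have ev_b: "\<forall>\<^sub>F N in sequentially. 0 < b N"
    using b_infinity by (simp add: filterlim_at_top_dense)
  have b_sq: "\<sigma> N = (\<Sum>j\<in>{1..N}. var N j)" if "1 \<le> N" for N
    unfolding \<sigma>_def b var_def closed_jackson_network.free_std_dev_eq[OF network r \<gamma>, OF that that]
    by (intro real_sqrt_pow2 sum_nonneg closed_jackson_network.free_var_nonneg[OF network r \<gamma>, OF that that])

  have good: "\<forall>\<^sub>F N in sequentially. 1 \<le> N \<and> K \<le> N \<and> 0 < b N \<and> 0 < \<gamma> N \<and> \<gamma> N * Max (r N ` J1 N) \<le> \<rho> \<and> 0 \<le> \<rho> \<and> \<rho> < 1"
    using ev_\<rho> ev_b eventually_ge_at_top[of 1] eventually_ge_at_top[of K]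
  proof eventually_elim
    case (elim N)
    note net = network[OF elim(3)]
    have 0: "0 \<le> \<gamma> N" by (rule closed_jackson_network.chemical_potential_nonneg[OF net r \<gamma>[OF elim(3)]])
    \<comment> \<open>For \<gamma> = 0 all free variables would be degenerate, contradicting b >
      0.\<close>
    have "\<gamma> N \<noteq> 0"
    proof
      assume "\<gamma> N = 0"
      then have "\<sigma> N = 0" by (auto simp: b_sq[OF elim(3)] var_def free_var_def intro!: sum.neutral)
      then show False using elim(2) by (simp add: \<sigma>_def)
    qed
    moreover have "0 \<le> \<gamma> N * Max (r N ` J1 N)"
    proof -
      obtain j where j: "j \<in> J1 N" using net by (auto simp: closed_jackson_network_def)
      then have "0 \<le> \<gamma> N * r N j"
        using closed_jackson_network.load_nonneg[OF net r \<gamma>[OF elim(3)]] closed_jackson_network.J1_subset[OF net] by auto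
      also have "\<dots> \<le> \<gamma> N * Max (r N ` J1 N)"
        by (rule closed_jackson_network.load_le_Max[OF net r \<gamma>[OF elim(3)] j])
      finally show ?thesis .
    qed
    ultimately show ?case using elim 0 \<rho>(2) by simp
  qed
  then have \<rho>01: "0 \<le> \<rho>" "\<rho> < 1" by (auto dest: eventually_happens)

  have D_nonneg: "\<forall>\<^sub>F N in sequentially. 0 \<le> D N"
    using good
    by eventually_elim (auto simp: D_def var_def intro!: sum_nonneg closed_jackson_network.free_var_nonneg[OF network r \<gamma>])
  have D_le: "\<forall>\<^sub>F N in sequentially. D N \<le> real K * (1 / (1 - \<rho>)\<^sup>2) + (\<Sum>j\<in>J2 N \<inter> {1..K}. \<gamma> N * r N j)"
    using good
  proof eventually_elim
    case (elim N)
    then have N: "1 \<le> N" by simp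
    note net = network[OF N]
    have "D N = (\<Sum>j\<in>J1 N \<inter> {1..K}. var N j) + (\<Sum>j\<in>J2 N \<inter> {1..K}. var N j)"
    proof -
      have "{1..K} = (J1 N \<inter> {1..K}) \<union> (J2 N \<inter> {1..K})"
        using elim closed_jackson_network.nodes(1)[OF net] by auto
      then show ?thesis unfolding D_def
        using closed_jackson_network.nodes(2)[OF net] by (subst sum.union_disjoint[symmetric]) auto
    qed
    also have "(\<Sum>j\<in>J1 N \<inter> {1..K}. var N j) \<le> real (card (J1 N \<inter> {1..K})) * (1 / (1 - \<rho>)\<^sup>2)"
      unfolding var_def
      by (rule sum_bounded_above) (use elim closed_jackson_network.free_var_le_const[OF net r \<gamma>[OF N]] in auto)
    also have "\<dots> \<le> real K * (1 / (1 - \<rho>)\<^sup>2)"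
      using card_mono[of "{1..K}" "J1 N \<inter> {1..K}"] by (intro mult_right_mono) auto
    also have "(\<Sum>j\<in>J2 N \<inter> {1..K}. var N j) = (\<Sum>j\<in>J2 N \<inter> {1..K}. \<gamma> N * r N j)"
      using closed_jackson_network.nodes(2)[OF net] by (intro sum.cong) (auto simp: var_def free_var_def)
    finally show ?case by simp
  qed
  have inv_b: "(\<lambda>N. 1 / b N) \<longlonglongrightarrow> 0"
    using tendsto_inverse_0_at_top[OF b_infinity] by (simp add: inverse_eq_divide)
  have D_b: "(\<lambda>N. D N / b N) \<longlonglongrightarrow> 0"
  proof (rule tendsto_sandwich)
    show "\<forall>\<^sub>F N in sequentially. 0 \<le> D N / b N"
      using D_nonneg ev_b by eventually_elim simp
    show "\<forall>\<^sub>F N in sequentially. D N / b N \<le>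
        real K * (1 / (1 - \<rho>)\<^sup>2) * (1 / b N) + 1 / b N * (\<Sum>j\<in>J2 N \<inter> {1..K}. \<gamma> N * r N j)"
      using D_le ev_b
    proof eventually_elim
      case (elim N)
      then show ?case using divide_right_mono[OF elim(1), of "b N"] by (simp add: add_divide_distrib)
    qed
    show "(\<lambda>N. real K * (1 / (1 - \<rho>)\<^sup>2) * (1 / b N) + 1 / b N * (\<Sum>j\<in>J2 N \<inter> {1..K}. \<gamma> N * r N j)) \<longlonglongrightarrow> 0"
      by (intro tendsto_add_zero tendsto_mult_right_zero inv_b J2_negligible)
  qed simp

  have split: "\<forall>\<^sub>F N in sequentially. v N = \<sigma> N - D N"
    using good
  proof eventually_elim
    case (elim N)
    then have "{1..N} = {1..K} \<union> {K+1..N}" by auto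
    then have "(\<Sum>j\<in>{1..N}. var N j) = D N + v N"
      unfolding D_def v_def by (simp only:) (subst sum.union_disjoint, auto)
    then show ?case using b_sq[of N] elim by simp
  qed
  have v_ratio: "(\<lambda>N. v N / \<sigma> N) \<longlonglongrightarrow> 1"
  proof (rule Lim_transform_eventually)
    \<comment> \<open>D / b^2 has one factor 1 / b to spare.\<close>
    show "(\<lambda>N. 1 - (D N / b N) * (1 / b N)) \<longlonglongrightarrow> 1"
      using tendsto_diff[OF tendsto_const tendsto_mult[OF D_b inv_b], of 1] by simp
    show "\<forall>\<^sub>F N in sequentially. 1 - (D N / b N) * (1 / b N) = v N / \<sigma> N"
      using split ev_b by eventually_elim (simp add: \<sigma>_def field_simps power2_eq_square)
  qed
  have \<sigma>_inf: "filterlim \<sigma> at_top sequentially"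
    unfolding \<sigma>_def by (rule filterlim_pow_at_top[OF _ b_infinity]) simp
  have v_inf: "filterlim v at_top sequentially"
  proof (rule filterlim_cong[THEN iffD1, OF refl refl])
    show "filterlim (\<lambda>N. v N / \<sigma> N * \<sigma> N) at_top sequentially"
      by (rule filterlim_tendsto_pos_mult_at_top[OF v_ratio _ \<sigma>_inf]) simp
    show "\<forall>\<^sub>F N in sequentially. v N / \<sigma> N * \<sigma> N = v N"
      using ev_b by eventually_elim (simp add: \<sigma>_def)
  qed
  have sqrt_ratio: "(\<lambda>N. sqrt (\<sigma> N) / sqrt (v N)) \<longlonglongrightarrow> 1"
  proof -
    have "(\<lambda>N. inverse (sqrt (v N / \<sigma> N))) \<longlonglongrightarrow> inverse (sqrt 1)"
      by (intro tendsto_inverse tendsto_real_sqrt v_ratio) simp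
    then show ?thesis by (simp add: real_sqrt_divide)
  qed

  \<comment> \<open>M \<ge> (1 - \<rho>) b^2 tends to infinity, so M - s is eventually a true
    difference.\<close>
  have M_ge: "\<forall>\<^sub>F N in sequentially. s \<le> M N"
  proof -
    have "\<forall>\<^sub>F N in sequentially. real s / (1 - \<rho>) \<le> \<sigma> N"
      using \<sigma>_inf by (simp add: filterlim_at_top)
    with good show ?thesis
    proof eventually_elim
      case (elim N)
      then have N: "1 \<le> N" by simp
      have "\<sigma> N \<le> (\<Sum>j\<in>{1..N}. mean N j / (1 - \<rho>))"
        unfolding b_sq[OF N] var_def mean_def
        using elim by (intro sum_mono closed_jackson_network.free_var_le[OF network[OF N] r \<gamma>[OF N]]) auto
      also have "\<dots> = real (M N) / (1 - \<rho>)"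
        unfolding mean_def using closed_jackson_network.sum_free_mean[OF network[OF N] r \<gamma>[OF N]]
        by (simp only: sum_divide_distrib[symmetric])
      finally have "real s / (1 - \<rho>) \<le> real (M N) / (1 - \<rho>)" using elim by linarith
      then show ?case using \<rho>01 by (simp add: divide_le_cancel)
    qed
  qed

  let ?C = "1 / (3 * (1 - \<rho>))" and ?c = "(1 - \<rho>)\<^sup>2 / 12"
  have c: "0 < ?c" using \<rho>01 by simp
  have cb: "\<forall>\<^sub>F N in sequentially. \<forall>A\<subseteq>{1..N}.
      cumulant_bounds ?C ?c (sum_law A (F N)) (\<Sum>j\<in>A. mean N j) (\<Sum>j\<in>A. var N j)"
    using good
  proof eventually_elim
    case (elim N)
    then have N: "1 \<le> N" by simp
    have "cumulant_bounds ?C ?c (F N j) (mean N j) (var N j)" if "j \<in> {1..N}" for j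
      unfolding F_def mean_def var_def
      using elim closed_jackson_network.cumulant_bounds_free_law[OF network[OF N] r \<gamma>[OF N], of \<rho> j] that by auto
    then show ?case by (auto intro!: cumulant_bounds_sum_law intro: finite_subset)
  qed
  have total: "(\<lambda>N. sqrt (\<sigma> N) * pmf (sum_law {1..N} (F N)) (M N)) \<longlonglongrightarrow> 1 / sqrt (2 * pi)"
  proof (rule local_limit_theorem_eventually[OF _ c \<sigma>_inf])
    show "\<forall>\<^sub>F N in sequentially. cumulant_bounds ?C ?c (sum_law {1..N} (F N)) (real (M N)) (\<sigma> N)"
      using cb good
    proof eventually_elim
      case (elim N)
      then have N: "1 \<le> N" by simp
      show ?case using elim(1) closed_jackson_network.sum_free_mean[OF network[OF N] r \<gamma>[OF N]] b_sq[OF N]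
        by (auto simp: mean_def)
    qed
  qed simp
  have rest: "(\<lambda>N. sqrt (v N) * pmf (sum_law {K+1..N} (F N)) (M N - s)) \<longlonglongrightarrow> 1 / sqrt (2 * pi)"
  proof (rule local_limit_theorem_eventually[OF _ c v_inf])
    show "\<forall>\<^sub>F N in sequentially. cumulant_bounds ?C ?c (sum_law {K+1..N} (F N)) (m N) (v N)"
      using cb by eventually_elim (auto simp: m_def v_def)
    \<comment> \<open>The centring error is first measured in units of b, where \<open>D_b\<close>
      applies, and then rescaled to sqrt v through \<open>sqrt_ratio\<close>.\<close>
    have "(\<lambda>N. (real (M N - s) - m N) / b N) \<longlonglongrightarrow> 0"
    proof (rule Lim_null_comparison)
      show "\<forall>\<^sub>F N in sequentially. norm ((real (M N - s) - m N) / b N) \<le> real s * (1 / b N) + D N / b N"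
        using good M_ge
      proof eventually_elim
        case (elim N)
        then have N: "1 \<le> N" by simp
        note jn = network[OF N] r \<gamma>[OF N]
        define d where "d = (\<Sum>j\<in>{1..K}. mean N j)"
        have "{1..N} = {1..K} \<union> {K+1..N}" using elim by auto
        then have "(\<Sum>j\<in>{1..N}. mean N j) = d + m N"
          unfolding d_def m_def by (simp only:) (subst sum.union_disjoint, auto)
        then have "real (M N) = d + m N"
          using closed_jackson_network.sum_free_mean[OF jn] by (simp add: mean_def)
        moreover have "0 \<le> d" unfolding d_def mean_def
          using elim by (intro sum_nonneg closed_jackson_network.free_mean_nonneg[OF jn]) auto
        moreover have "d \<le> D N" unfolding d_def D_def mean_def var_def
          using elim by (intro sum_mono closed_jackson_network.free_mean_le_var[OF jn]) auto
        ultimately have "\<bar>real (M N - s) - m N\<bar> \<le> real s + D N"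
          using elim by (simp add: of_nat_diff)
        then show ?case
          using elim divide_right_mono[of "\<bar>real (M N - s) - m N\<bar>" "real s + D N" "b N"]
          by (simp add: add_divide_distrib)
      qed
      show "(\<lambda>N. real s * (1 / b N) + D N / b N) \<longlonglongrightarrow> 0"
        by (intro tendsto_add_zero tendsto_mult_right_zero inv_b D_b)
    qed
    from tendsto_mult[OF this sqrt_ratio]
    have lim: "(\<lambda>N. (real (M N - s) - m N) / b N * (sqrt (\<sigma> N) / sqrt (v N))) \<longlonglongrightarrow> 0" by simp
    show "(\<lambda>N. (real (M N - s) - m N) / sqrt (v N)) \<longlonglongrightarrow> 0"
    proof (rule Lim_transform_eventually[OF lim])
      show "\<forall>\<^sub>F N in sequentially. (real (M N - s) - m N) / b N * (sqrt (\<sigma> N) / sqrt (v N)) = (real (M N - s) - m N) / sqrt (v N)"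
        using ev_b by eventually_elim (simp add: \<sigma>_def)
    qed
  qed
  \<comment> \<open>The last factor undoes the two different normalizations, leaving the bare
    quotient of point probabilities.\<close>
  have "(\<lambda>N. (sqrt (v N) * pmf (sum_law {K+1..N} (F N)) (M N - s)) / (sqrt (\<sigma> N) * pmf (sum_law {1..N} (F N)) (M N))
      * (sqrt (\<sigma> N) / sqrt (v N))) \<longlonglongrightarrow> (1 / sqrt (2 * pi)) / (1 / sqrt (2 * pi)) * 1"
    by (intro tendsto_mult tendsto_divide rest total sqrt_ratio) simp
  then have lim: "(\<lambda>N. (sqrt (v N) * pmf (sum_law {K+1..N} (F N)) (M N - s)) / (sqrt (\<sigma> N) * pmf (sum_law {1..N} (F N)) (M N))
      * (sqrt (\<sigma> N) / sqrt (v N))) \<longlonglongrightarrow> 1"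
    by simp
  have ev_v: "\<forall>\<^sub>F N in sequentially. 0 < v N"
    using v_inf by (simp add: filterlim_at_top_dense)
  show ?thesis
  proof (rule Lim_transform_eventually[OF lim])
    show "\<forall>\<^sub>F N in sequentially. (sqrt (v N) * pmf (sum_law {K+1..N} (F N)) (M N - s)) / (sqrt (\<sigma> N) * pmf (sum_law {1..N} (F N)) (M N))
      * (sqrt (\<sigma> N) / sqrt (v N)) = measure_pmf.prob (\<xi> N) {x. \<forall>j\<in>{1..K}. x j = n j} /
              (\<Prod>j\<in>{1..K}. measure_pmf.prob (\<eta> N) {x. x j = n j})"
      using good M_ge ev_v
    proof eventually_elim
      case (elim N)
      then have N: "1 \<le> N" by simp
      have "measure_pmf.prob (\<xi> N) {x. \<forall>j\<in>{1..K}. x j = n j} / (\<Prod>j\<in>{1..K}. measure_pmf.prob (\<eta> N) {x. x j = n j})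
         = pmf (sum_law {K+1..N} (F N)) (M N - s) / pmf (sum_law {1..N} (F N)) (M N)"
        unfolding \<eta> F_def s_def
        by (rule closed_jackson_network.prob_stationary_cylinder[OF network[OF N] r \<gamma>[OF N] \<xi>[OF N]])
          (use elim in \<open>auto simp: s_def\<close>)
      moreover have "sqrt (v N) \<noteq> 0" "sqrt (\<sigma> N) \<noteq> 0" using elim by (auto simp: \<sigma>_def)
      ultimately show ?case by (simp del: real_sqrt_eq_zero_cancel_iff)
    qed
  qed
qed

end
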